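(* Let $m,n,l\ge 1$ be integers, let $\mathcal X=\{\mathbf x^{(1)},\dots,\mathbf x^{(l)}\}$ with $\mathbf x^{(i)}\in\mathbb R^n$ and $\mathcal Y=\{\mathbf y^{(1)},\dots,\mathbf y^{(l)}\}$ with $\mathbf y^{(i)}\in\mathbb R^m$, $1\le i\le l$, be given, let $s\in\mathbb R$, and let $c_3^{(s)}$ be a finite positive real number. For $\beta>0$, $c_3>0$ and $t\in[0,1]$ let $\psi_*(\mathcal X,\mathcal Y,\beta,s,c_3,t)$ be the function defined in the context. Then for all sufficiently large $\beta$ the function $t\mapsto\psi_*\left(\mathcal X,\mathcal Y,\beta,s,\frac{c_3^{(s)}}{\beta},t\right)$ is non-increasing on $[0,1]$, and for every $t\in[0,1]$ $$\lim_{\beta\to\infty}\psi_*\left(\mathcal X,\mathcal Y,\beta,s,\tfrac{c_3^{(s)}}{\beta},0\right)\ \ge\ \lim_{\beta\to\infty}\psi_*\left(\mathcal X,\mathcal Y,\beta,s,\tfrac{c_3^{(s)}}{\beta},t\right)\ \ge\ \lim_{\beta\to\infty}\psi_*\left(\mathcal X,\mathcal Y,\beta,s,\tfrac{c_3^{(s)}}{\beta},1\right).$$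
   Context: $G\in\mathbb R^{m\times n}$, $u^{(4)}\in\mathbb R$, $\mathbf u^{(2)}\in\mathbb R^m$, $\mathbf h\in\mathbb R^n$ have i.i.d. standard normal components and are independent of each other; $\mathbb E$ is expectation over all of them. For $t\in[0,1]$, $$H_t^{(i_1,i_2)}=\sqrt t\,(\mathbf y^{(i_2)})^TG\mathbf x^{(i_1)}+\sqrt{1-t}\,\|\mathbf x^{(i_1)}\|_2(\mathbf y^{(i_2)})^T\mathbf u^{(2)}+\sqrt t\,\|\mathbf x^{(i_1)}\|_2\|\mathbf y^{(i_2)}\|_2\,u^{(4)}+\sqrt{1-t}\,\|\mathbf y^{(i_2)}\|_2\,\mathbf h^T\mathbf x^{(i_1)},$$ $$\psi_*(\mathcal X,\mathcal Y,\beta,s,c_3,t)=\mathbb E\left(\sum_{i_1=1}^{l}\left(\sum_{i_2=1}^{l}e^{\beta H_t^{(i_1,i_2)}}\right)^{s}\right)^{c_3}.$$ The superscript in $c_3^{(s)}$ is only a label; $c_3^{(s)}$ is a constant not depending on $\beta$. *)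

theory Defs
  imports "HOL-Probability.Probability"
begin

datatype ('m, 'n) gauss_index = IdxG 'm 'n | IdxU2 'm | IdxH 'n | IdxU4

fun gauss_component ::
  "('w \<Rightarrow> real^'n^'m) \<Rightarrow> ('w \<Rightarrow> real^'m) \<Rightarrow> ('w \<Rightarrow> real^'n) \<Rightarrow> ('w \<Rightarrow> real)
    \<Rightarrow> ('m, 'n) gauss_index \<Rightarrow> 'w \<Rightarrow> real" where
  "gauss_component G u2 h u4 (IdxG i j) = (\<lambda>\<omega>. G \<omega> $ i $ j)"
| "gauss_component G u2 h u4 (IdxU2 i) = (\<lambda>\<omega>. u2 \<omega> $ i)"
| "gauss_component G u2 h u4 (IdxH j) = (\<lambda>\<omega>. h \<omega> $ j)"
| "gauss_component G u2 h u4 IdxU4 = u4"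

text \<open>Requiring mutual independence of the whole family of scalar components covers both the
  independence within each of the four objects and their independence from each other.\<close>

definition iid_std_normal_components ::
  "'w measure \<Rightarrow> ('w \<Rightarrow> real^'n^'m) \<Rightarrow> ('w \<Rightarrow> real^'m) \<Rightarrow> ('w \<Rightarrow> real^'n) \<Rightarrow> ('w \<Rightarrow> real)
    \<Rightarrow> bool" where
  "iid_std_normal_components M G u2 h u4 \<longleftrightarrow>
     prob_space.indep_vars M (\<lambda>_. borel) (gauss_component G u2 h u4) UNIV \<and>
     (\<forall>k. distributed M lborel (gauss_component G u2 h u4 k) std_normal_density)"

definition H_interp ::
  "real^'n^'m \<Rightarrow> real^'m \<Rightarrow> real^'n \<Rightarrow> real \<Rightarrow> real \<Rightarrow> real^'n \<Rightarrow> real^'m \<Rightarrow> real" where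
  "H_interp G u2 h u4 t x y =
     sqrt t * (y \<bullet> (G *v x)) + sqrt (1 - t) * norm x * (y \<bullet> u2)
     + sqrt t * norm x * norm y * u4 + sqrt (1 - t) * norm y * (h \<bullet> x)"

text \<open>The sets are given as families \<open>x 1, \<dots>, x l\<close> and \<open>y 1, \<dots>, y l\<close>, repetitions allowed.
  For \<open>l \<ge> 1\<close> both bases of \<open>powr\<close> are positive, so it is the ordinary real power.\<close>

definition psi_star ::
  "'w measure \<Rightarrow> ('w \<Rightarrow> real^'n^'m) \<Rightarrow> ('w \<Rightarrow> real^'m) \<Rightarrow> ('w \<Rightarrow> real^'n) \<Rightarrow> ('w \<Rightarrow> real)
    \<Rightarrow> nat \<Rightarrow> (nat \<Rightarrow> real^'n) \<Rightarrow> (nat \<Rightarrow> real^'m) \<Rightarrow> real \<Rightarrow> real \<Rightarrow> real \<Rightarrow> real \<Rightarrow> real" where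
  "psi_star M G u2 h u4 l x y \<beta> s c3 t =
     (LINT \<omega>|M. (\<Sum>i1 = 1..l. (\<Sum>i2 = 1..l.
        exp (\<beta> * H_interp (G \<omega>) (u2 \<omega>) (h \<omega>) (u4 \<omega>) t (x i1) (y i2))) powr s) powr c3)"

end

theory Submission
  imports Defs "HOL-Real_Asymp.Real_Asymp"
begin

text \<open>
  Put \<open>t = sin\<^sup>2 \<theta>\<close>, which removes the singularities of \<open>sqrt t\<close> and \<open>sqrt (1 - t)\<close> at the endpoints, and
  write the integrand as \<open>F = (\<Sum>i. Z i powr s) powr c\<close> with \<open>Z i = (\<Sum>k. exp (\<beta> H i k))\<close>. Gaussian
  integration by parts turns the \<open>\<theta>\<close>-derivative of \<open>\<integral> F\<close> into an expectation of second derivatives of \<open>F\<close>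
  weighted with the derivative of the covariance, which is
  \<open>sin \<theta> cos \<theta> (|x i| |x i'| - x i \<bullet> x i') (|y k| |y k'| - y k \<bullet> y k')\<close>. By Cauchy-Schwarz it is nonnegative, and
  it vanishes for \<open>i = i'\<close>. Only the mixed second derivatives with \<open>i \<noteq> i'\<close> survive; they carry the factor
  \<open>c (c - 1) s\<^sup>2\<close>, which is \<open>\<le> 0\<close> as soon as \<open>c \<le> 1\<close>, that is \<open>\<beta> \<ge> c3s\<close>. For \<open>\<beta> \<rightarrow> \<infinity>\<close> the integrand converges to
  \<open>exp (c3s * (MAX i. s * (MAX k. H i k)))\<close>, dominated by an exponential of the Gaussian coordinates.
\<close>

section \<open>The lifted partition function along a path\<close>

locale lifted_sum =
  fixes I :: "'a set" and J :: "'b set" and \<beta> s c :: real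
  assumes finite_I: "finite I" and finite_J: "finite J"
    and I_ne: "I \<noteq> {}" and J_ne: "J \<noteq> {}"
begin

definition Z :: "('a \<Rightarrow> 'b \<Rightarrow> real) \<Rightarrow> 'a \<Rightarrow> real" where
  "Z z i = (\<Sum>k\<in>J. exp (\<beta> * z i k))"

definition S :: "('a \<Rightarrow> 'b \<Rightarrow> real) \<Rightarrow> real" where
  "S z = (\<Sum>i\<in>I. Z z i powr s)"

definition F :: "('a \<Rightarrow> 'b \<Rightarrow> real) \<Rightarrow> real" where
  "F z = S z powr c"

text \<open>Gibbs weight of the pair \<open>(i, k)\<close>: draw row \<open>i\<close> with
  probability \<open>Z z i powr s / S z\<close>, then \<open>k\<close> in that row with probability
  \<open>exp (\<beta> * z i k) / Z z i\<close>. Up to a factor it is the gradient of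
  \<open>F\<close>: the partial derivative in \<open>z i k\<close> is
  \<open>c * s * \<beta> * F z * w z i k\<close>.\<close>

definition w :: "('a \<Rightarrow> 'b \<Rightarrow> real) \<Rightarrow> 'a \<Rightarrow> 'b \<Rightarrow> real" where
  "w z i k = Z z i powr s / S z * (exp (\<beta> * z i k) / Z z i)"

definition mean :: "('a \<Rightarrow> 'b \<Rightarrow> real) \<Rightarrow> ('a \<Rightarrow> 'b \<Rightarrow> real) \<Rightarrow> real" where
  "mean z v = (\<Sum>i\<in>I. \<Sum>k\<in>J. w z i k * v i k)"

text \<open>Conditional Gibbs average given row \<open>i\<close>; it arises because differentiating
  a power of \<open>Z z i\<close> involves that row only.\<close>

definition row_mean :: "('a \<Rightarrow> 'b \<Rightarrow> real) \<Rightarrow> 'a \<Rightarrow> ('a \<Rightarrow> 'b \<Rightarrow> real) \<Rightarrow> real" where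
  "row_mean z i v = (\<Sum>k\<in>J. exp (\<beta> * z i k) / Z z i * v i k)"

lemma Z_pos: "Z z i > 0"
  unfolding Z_def by (intro sum_pos finite_J J_ne) auto

lemma S_pos: "S z > 0"
  unfolding S_def by (intro sum_pos finite_I I_ne) (simp add: Z_pos less_imp_neq[symmetric])

lemma F_pos: "F z > 0"
  unfolding F_def using S_pos[of z] by simp

lemma w_nonneg: "w z i k \<ge> 0"
  unfolding w_def using S_pos[of z] Z_pos[of z i] by simp

lemma w_le_1:
  assumes "i \<in> I" "k \<in> J"
  shows "w z i k \<le> 1"
proof -
  have "Z z i powr s \<le> S z"
    unfolding S_def by (rule member_le_sum) (use assms finite_I in auto)
  moreover have "exp (\<beta> * z i k) \<le> Z z i"
    unfolding Z_def by (rule member_le_sum[where f = "\<lambda>k. exp (\<beta> * z i k)"]) (use assms finite_J in auto)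
  ultimately show ?thesis
    unfolding w_def using S_pos[of z] Z_pos[of z i] by (intro mult_le_one) auto
qed

lemma gibbs_row_bounds:
  assumes "k \<in> J"
  shows "0 \<le> exp (\<beta> * z i k) / Z z i" "exp (\<beta> * z i k) / Z z i \<le> 1"
proof -
  have "exp (\<beta> * z i k) \<le> Z z i"
    unfolding Z_def by (rule member_le_sum[where f = "\<lambda>k. exp (\<beta> * z i k)"]) (use assms finite_J in auto)
  then show "0 \<le> exp (\<beta> * z i k) / Z z i" "exp (\<beta> * z i k) / Z z i \<le> 1"
    using Z_pos[of z i] by auto
qed

text \<open>Cancelling the quotients in \<open>w\<close> leaves two powers and one exponential,
  which the product rule differentiates directly.\<close>

lemma F_w_eq:
  "F z * w z i k = S z powr (c - 1) * Z z i powr (s - 1) * exp (\<beta> * z i k)"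
  unfolding F_def w_def using S_pos[of z] Z_pos[of z i] by (simp add: powr_diff field_simps)

text \<open>Every weight is at most 1; the resulting cardinality factor is not sharp but suffices
  for integrable envelopes.\<close>

lemma abs_mean_le:
  fixes V :: real
  assumes "\<And>i k. i \<in> I \<Longrightarrow> k \<in> J \<Longrightarrow> \<bar>v i k\<bar> \<le> V"
  shows "\<bar>mean z v\<bar> \<le> card I * card J * V"
proof -
  have "\<bar>mean z v\<bar> \<le> (\<Sum>i\<in>I. \<Sum>k\<in>J. \<bar>w z i k * v i k\<bar>)"
    unfolding mean_def by (rule order_trans[OF sum_abs]) (intro sum_mono sum_abs)
  also have "\<dots> \<le> (\<Sum>i\<in>I. \<Sum>k\<in>J. V)"
  proof (intro sum_mono)
    fix i k assume *: "i \<in> I" "k \<in> J"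
    have "\<bar>w z i k * v i k\<bar> = w z i k * \<bar>v i k\<bar>"
      by (simp add: abs_mult w_nonneg)
    also have "\<dots> \<le> 1 * V"
      by (intro mult_mono w_le_1 assms *) auto
    finally show "\<bar>w z i k * v i k\<bar> \<le> V" by simp
  qed
  finally show ?thesis by simp
qed

lemma abs_row_mean_le:
  fixes V :: real
  assumes "\<And>k. k \<in> J \<Longrightarrow> \<bar>v i k\<bar> \<le> V"
  shows "\<bar>row_mean z i v\<bar> \<le> card J * V"
proof -
  have "\<bar>row_mean z i v\<bar> \<le> (\<Sum>k\<in>J. \<bar>exp (\<beta> * z i k) / Z z i * v i k\<bar>)"
    unfolding row_mean_def by (rule sum_abs)
  also have "\<dots> \<le> (\<Sum>k\<in>J. V)"
  proof (intro sum_mono)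
    fix k assume *: "k \<in> J"
    have "\<bar>exp (\<beta> * z i k) / Z z i * v i k\<bar> = exp (\<beta> * z i k) / Z z i * \<bar>v i k\<bar>"
      by (simp only: abs_mult abs_of_nonneg[OF gibbs_row_bounds(1)[OF *]])
    also have "\<dots> \<le> 1 * V"
      by (intro mult_mono gibbs_row_bounds assms *) auto
    finally show "\<bar>exp (\<beta> * z i k) / Z z i * v i k\<bar> \<le> V" by simp
  qed
  finally show ?thesis by simp
qed

text \<open>The sign of \<open>s\<close> is arbitrary, so \<open>Z\<close> is bounded from both
  sides: a bound on the absolute value of \<open>ln (Z z i)\<close> controls
  \<open>Z z i powr s\<close> through \<open>\<bar>s\<bar>\<close>.\<close>

lemma F_le:
  fixes M :: real
  assumes "\<And>i k. i \<in> I \<Longrightarrow> k \<in> J \<Longrightarrow> \<bar>z i k\<bar> \<le> M" and "\<beta> > 0" "c > 0"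
  shows "F z \<le> (card I * card J powr \<bar>s\<bar>) powr c * exp (c * \<bar>s\<bar> * \<beta> * M)"
proof -
  let ?n = "real (card J)"
  have n: "?n \<ge> 1" using finite_J J_ne by (simp add: card_gt_0_iff Suc_le_eq)
  have "Z z i powr s \<le> ?n powr \<bar>s\<bar> * exp (\<bar>s\<bar> * \<beta> * M)" if i: "i \<in> I" for i
  proof -
    have up: "Z z i \<le> ?n * exp (\<beta> * M)"
    proof -
      have "Z z i \<le> (\<Sum>k\<in>J. exp (\<beta> * M))"
        unfolding Z_def using assms(1)[OF i] \<open>\<beta> > 0\<close>
        by (intro sum_mono) (fastforce dest: abs_le_D1)
      then show ?thesis by simp
    qed
    have lo: "exp (- (\<beta> * M)) \<le> Z z i"
    proof -
      obtain k where k: "k \<in> J" using J_ne by auto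
      have "- M \<le> z i k" using assms(1)[OF i k] by auto
      then have "\<beta> * - M \<le> \<beta> * z i k" using \<open>\<beta> > 0\<close> by (intro mult_left_mono) auto
      then have "exp (- (\<beta> * M)) \<le> exp (\<beta> * z i k)" by simp
      also have "\<dots> \<le> Z z i"
        unfolding Z_def by (rule member_le_sum[where f = "\<lambda>k. exp (\<beta> * z i k)"]) (use k finite_J in auto)
      finally show ?thesis .
    qed
    have "ln (Z z i) \<le> ln ?n + \<beta> * M"
      using ln_mono[OF up Z_pos] n by (simp add: ln_mult)
    moreover have "- (\<beta> * M) \<le> ln (Z z i)"
      using ln_mono[OF lo] by simp
    \<comment> \<open>With this sign the lower bound \<open>- (\<beta> * M)\<close> also fits into
      the symmetric bound.\<close>
    moreover have "ln ?n \<ge> 0" using n by simp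
    ultimately have L: "\<bar>ln (Z z i)\<bar> \<le> ln ?n + \<beta> * M" by auto
    have "Z z i powr s = exp (s * ln (Z z i))"
      using Z_pos[of z i] by (simp add: powr_def)
    also have "\<dots> \<le> exp (\<bar>s\<bar> * (ln ?n + \<beta> * M))"
    proof -
      have "s * ln (Z z i) \<le> \<bar>s\<bar> * \<bar>ln (Z z i)\<bar>"
        by (metis abs_ge_self abs_mult)
      also have "\<dots> \<le> \<bar>s\<bar> * (ln ?n + \<beta> * M)" by (intro mult_left_mono L) auto
      finally show ?thesis by simp
    qed
    also have "\<dots> = ?n powr \<bar>s\<bar> * exp (\<bar>s\<bar> * \<beta> * M)"
      using n by (simp add: powr_def distrib_left exp_add mult.assoc)
    finally show ?thesis .
  qed
  then have "S z \<le> card I * (?n powr \<bar>s\<bar> * exp (\<bar>s\<bar> * \<beta> * M))"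
    unfolding S_def using sum_mono[of I "\<lambda>i. Z z i powr s" "\<lambda>_. ?n powr \<bar>s\<bar> * exp (\<bar>s\<bar> * \<beta> * M)"]
    by simp
  then have "F z \<le> (card I * (?n powr \<bar>s\<bar> * exp (\<bar>s\<bar> * \<beta> * M))) powr c"
    unfolding F_def using S_pos[of z] \<open>c > 0\<close> by (intro powr_mono2) auto
  also have "\<dots> = ((card I * ?n powr \<bar>s\<bar>) * exp (\<bar>s\<bar> * \<beta> * M)) powr c"
    by (simp only: mult.assoc)
  also have "\<dots> = (card I * ?n powr \<bar>s\<bar>) powr c * exp (\<bar>s\<bar> * \<beta> * M) powr c"
    by (rule powr_mult)
  also have "exp (\<bar>s\<bar> * \<beta> * M) powr c = exp (c * \<bar>s\<bar> * \<beta> * M)"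
    by (simp add: powr_def)
  finally show ?thesis .
qed

section \<open>Derivatives along a differentiable path of fields\<close>

context
  fixes z :: "real \<Rightarrow> 'a \<Rightarrow> 'b \<Rightarrow> real" and v :: "'a \<Rightarrow> 'b \<Rightarrow> real" and \<tau> :: real
  assumes z: "\<And>i k. i \<in> I \<Longrightarrow> k \<in> J \<Longrightarrow> ((\<lambda>\<tau>. z \<tau> i k) has_real_derivative v i k) (at \<tau>)"
begin

text \<open>Logarithmic differentiation: a power reproduces itself times a Gibbs average. The
  exponent \<open>r\<close> stays free because both \<open>s\<close> and \<open>s - 1\<close> occur
  below, just as \<open>c\<close> and \<open>c - 1\<close> do for \<open>S\<close>.\<close>

lemma DERIV_Z_powr:
  assumes "i \<in> I"
  shows "((\<lambda>\<tau>. Z (z \<tau>) i powr r) has_real_derivative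
           r * \<beta> * row_mean (z \<tau>) i v * Z (z \<tau>) i powr r) (at \<tau>)"
proof -
  have "((\<lambda>\<tau>. Z (z \<tau>) i) has_real_derivative (\<Sum>k\<in>J. exp (\<beta> * z \<tau> i k) * (\<beta> * v i k))) (at \<tau>)"
    unfolding Z_def by (intro DERIV_sum) (auto intro!: derivative_eq_intros z[OF assms])
  also have "(\<Sum>k\<in>J. exp (\<beta> * z \<tau> i k) * (\<beta> * v i k)) = \<beta> * Z (z \<tau>) i * row_mean (z \<tau>) i v"
    unfolding row_mean_def using Z_pos[of "z \<tau>" i] by (simp add: sum_distrib_left field_simps)
  finally have "((\<lambda>\<tau>. Z (z \<tau>) i powr r) has_real_derivative
      r * Z (z \<tau>) i powr (r - of_nat 1) * (\<beta> * Z (z \<tau>) i * row_mean (z \<tau>) i v)) (at \<tau>)"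
    by (rule DERIV_fun_powr) (rule Z_pos)
  also have "r * Z (z \<tau>) i powr (r - of_nat 1) * (\<beta> * Z (z \<tau>) i * row_mean (z \<tau>) i v)
      = r * \<beta> * row_mean (z \<tau>) i v * Z (z \<tau>) i powr r"
    using Z_pos[of "z \<tau>" i] by (simp add: powr_diff)
  finally show ?thesis .
qed

lemma DERIV_S_powr:
  "((\<lambda>\<tau>. S (z \<tau>) powr r) has_real_derivative
     r * s * \<beta> * mean (z \<tau>) v * S (z \<tau>) powr r) (at \<tau>)"
proof -
  have "((\<lambda>\<tau>. S (z \<tau>)) has_real_derivative
      (\<Sum>i\<in>I. s * \<beta> * row_mean (z \<tau>) i v * Z (z \<tau>) i powr s)) (at \<tau>)"
    unfolding S_def by (intro DERIV_sum DERIV_Z_powr)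
  also have "(\<Sum>i\<in>I. s * \<beta> * row_mean (z \<tau>) i v * Z (z \<tau>) i powr s) = s * \<beta> * S (z \<tau>) * mean (z \<tau>) v"
  proof -
    have "S (z \<tau>) * mean (z \<tau>) v = (\<Sum>i\<in>I. row_mean (z \<tau>) i v * Z (z \<tau>) i powr s)"
      unfolding mean_def w_def row_mean_def using S_pos[of "z \<tau>"]
      by (simp add: sum_distrib_left sum_distrib_right field_simps)
    then show ?thesis by (simp add: sum_distrib_left mult.assoc)
  qed
  finally have "((\<lambda>\<tau>. S (z \<tau>) powr r) has_real_derivative
      r * S (z \<tau>) powr (r - of_nat 1) * (s * \<beta> * S (z \<tau>) * mean (z \<tau>) v)) (at \<tau>)"
    by (rule DERIV_fun_powr) (rule S_pos)
  also have "r * S (z \<tau>) powr (r - of_nat 1) * (s * \<beta> * S (z \<tau>) * mean (z \<tau>) v)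
      = r * s * \<beta> * mean (z \<tau>) v * S (z \<tau>) powr r"
    using S_pos[of "z \<tau>"] by (simp add: powr_diff)
  finally show ?thesis .
qed

lemma DERIV_F:
  "((\<lambda>\<tau>. F (z \<tau>)) has_real_derivative c * s * \<beta> * (F (z \<tau>) * mean (z \<tau>) v)) (at \<tau>)"
  unfolding F_def using DERIV_S_powr[of c] by (simp add: mult_ac)

text \<open>The three summands come from the three factors in \<open>F_w_eq\<close>: the power of
  \<open>S\<close>, the power of \<open>Z\<close> in row \<open>i\<close>, and the
  exponential.\<close>

lemma DERIV_F_w:
  assumes "i \<in> I" "k \<in> J"
  shows "((\<lambda>\<tau>. F (z \<tau>) * w (z \<tau>) i k) has_real_derivative
    \<beta> * (F (z \<tau>) * w (z \<tau>) i k) *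
      ((c - 1) * s * mean (z \<tau>) v + (s - 1) * row_mean (z \<tau>) i v + v i k)) (at \<tau>)"
  unfolding F_w_eq
  by (rule derivative_eq_intros DERIV_S_powr DERIV_Z_powr z assms refl)+
     (simp add: algebra_simps)

end

end

section \<open>Gaussian integration by parts and differentiation under the integral\<close>

definition std_normal :: "real measure" where
  "std_normal = density lborel (\<lambda>x. ennreal (std_normal_density x))"

lemma sets_std_normal [simp, measurable_cong]: "sets std_normal = sets borel"
  by (simp add: std_normal_def)

lemma space_std_normal [simp]: "space std_normal = UNIV"
  by (simp add: std_normal_def)

lemma prob_space_std_normal: "prob_space std_normal"
  unfolding std_normal_def by (rule prob_space_normal_density) simp

lemma integrable_std_normal_iff:
  fixes f :: "real \<Rightarrow> real"
  assumes [measurable]: "f \<in> borel_measurable borel"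
  shows "integrable std_normal f \<longleftrightarrow> integrable lborel (\<lambda>x. f x * std_normal_density x)"
  unfolding std_normal_def
  by (subst integrable_density) (auto simp: mult.commute)

lemma integral_std_normal:
  fixes f :: "real \<Rightarrow> real"
  assumes [measurable]: "f \<in> borel_measurable borel"
  shows "integral\<^sup>L std_normal f = (LINT x|lborel. f x * std_normal_density x)"
  unfolding std_normal_def
  by (subst integral_density) (auto simp: mult.commute)

text \<open>Completing the square: an exponential tilt by \<open>B\<close> yields a multiple of the
  normal density with mean \<open>B\<close>, hence an integrable function.\<close>

lemma std_normal_density_exp_shift:
  "exp (B * x) * std_normal_density x = exp (B\<^sup>2 / 2) * normal_density B 1 x"
  unfolding normal_density_def
  by (simp add: exp_add[symmetric] power2_eq_square field_simps)

lemma integrable_std_normal_exp_abs: "integrable std_normal (\<lambda>x. exp (B * \<bar>x\<bar>))"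
proof (subst integrable_std_normal_iff)
  have e: "integrable lborel (\<lambda>x. exp (B * x) * std_normal_density x)" for B
    unfolding std_normal_density_exp_shift
    by (intro integrable_mult_right integrable_normal_density) simp
  show "integrable lborel (\<lambda>x. exp (B * \<bar>x\<bar>) * std_normal_density x)"
  proof (rule Bochner_Integration.integrable_bound[OF Bochner_Integration.integrable_add[OF e[of B] e[of "- B"]]])
    show "AE x in lborel. norm (exp (B * \<bar>x\<bar>) * std_normal_density x)
        \<le> norm (exp (B * x) * std_normal_density x + exp (- B * x) * std_normal_density x)"
    proof (rule AE_I2)
      fix x :: real
      have "exp (B * \<bar>x\<bar>) \<le> exp (B * x) + exp (- B * x)"
        by (cases "x \<ge> 0") auto
      then have "exp (B * \<bar>x\<bar>) * std_normal_density x \<le> (exp (B * x) + exp (- B * x)) * std_normal_density x"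
        by (intro mult_right_mono) auto
      then show "norm (exp (B * \<bar>x\<bar>) * std_normal_density x)
        \<le> norm (exp (B * x) * std_normal_density x + exp (- B * x) * std_normal_density x)"
        by (simp add: distrib_right)
    qed
  qed measurable
qed measurable

text \<open>These limits dispose of the boundary terms at both ends in the integration by parts
  below.\<close>

lemma exp_abs_times_density_tendsto_0:
  "((\<lambda>x. exp (B * \<bar>x\<bar>) * std_normal_density x) \<longlongrightarrow> 0) at_top"
  "((\<lambda>x. exp (B * \<bar>x\<bar>) * std_normal_density x) \<longlongrightarrow> 0) at_bot"
proof -
  have "filterlim (\<lambda>x. x * (x / 2 - B)) at_top at_top"
    by real_asymp
  then have "((\<lambda>x. exp (- (x * (x / 2 - B)))) \<longlongrightarrow> 0) at_top"
    by (intro filterlim_compose[OF exp_at_bot]) (simp add: filterlim_uminus_at_top)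
  moreover have "exp (B * x) * std_normal_density x = 1 / sqrt (2 * pi) * exp (- (x * (x / 2 - B)))" for x
    by (simp add: normal_density_def exp_add[symmetric] power2_eq_square field_simps)
  ultimately have *: "((\<lambda>x. exp (B * x) * std_normal_density x) \<longlongrightarrow> 0) at_top"
    by (simp add: tendsto_divide_zero)
  then show t: "((\<lambda>x. exp (B * \<bar>x\<bar>) * std_normal_density x) \<longlongrightarrow> 0) at_top"
    by (rule Lim_transform_eventually) (auto intro!: eventually_at_top_linorderI[of 0])
  \<comment> \<open>Evenness carries the limit at the right end over to the left end.\<close>
  have "std_normal_density (- x) = std_normal_density x" for x
    by (simp add: normal_density_def)
  with t show "((\<lambda>x. exp (B * \<bar>x\<bar>) * std_normal_density x) \<longlongrightarrow> 0) at_bot"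
    by (simp add: filterlim_at_bot_mirror)
qed

text \<open>Stein's identity. The density \<open>\<phi>\<close> satisfies
  \<open>\<phi>' = - x * \<phi>\<close>, so \<open>f * \<phi>\<close> has derivative
  \<open>f' * \<phi> - x * f * \<phi>\<close>, whose integral over the line vanishes because
  \<open>f * \<phi>\<close> tends to 0 at both ends. Continuity of \<open>f'\<close> serves the
  fundamental theorem of calculus.\<close>

lemma stein_std_normal:
  fixes f f' :: "real \<Rightarrow> real"
  assumes deriv: "\<And>x. (f has_real_derivative f' x) (at x)"
    and cont: "\<And>x. isCont f' x"
    and f: "\<And>x. \<bar>f x\<bar> \<le> C * exp (B * \<bar>x\<bar>)"
    and f': "\<And>x. \<bar>f' x\<bar> \<le> C' * exp (B' * \<bar>x\<bar>)"
  shows "(\<integral>x. x * f x \<partial>std_normal) = (\<integral>x. f' x \<partial>std_normal)"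
proof -
  have [measurable]: "f \<in> borel_measurable borel" "f' \<in> borel_measurable borel"
    using deriv cont
    by (auto intro!: borel_measurable_continuous_onI continuous_at_imp_continuous_on intro: DERIV_isCont)
  have C: "C \<ge> 0" using f[of 0] by (simp add: order_trans[OF abs_ge_zero])
  have "integrable std_normal f'"
    by (rule Bochner_Integration.integrable_bound[OF integrable_mult_right[OF integrable_std_normal_exp_abs[of B'], of C']])
       (use f' in \<open>auto intro: order_trans[OF _ abs_ge_self]\<close>)
  then have i': "integrable lborel (\<lambda>x. f' x * std_normal_density x)"
    by (simp add: integrable_std_normal_iff)
  have "integrable std_normal (\<lambda>x. x * f x)"
  proof (rule Bochner_Integration.integrable_bound[OF integrable_mult_right[OF integrable_std_normal_exp_abs[of "1 + B"], of C]])
    show "AE x in std_normal. norm (x * f x) \<le> norm (C * exp ((1 + B) * \<bar>x\<bar>))"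
    proof (rule AE_I2)
      fix x :: real
      \<comment> \<open>Absorbs the factor \<open>x\<close> at the price of raising the exponential
        rate by 1.\<close>
      have "\<bar>x\<bar> \<le> exp \<bar>x\<bar>" using exp_ge_add_one_self[of "\<bar>x\<bar>"] by linarith
      then have "\<bar>x\<bar> * \<bar>f x\<bar> \<le> exp \<bar>x\<bar> * (C * exp (B * \<bar>x\<bar>))"
        by (intro mult_mono f) auto
      also have "\<dots> = C * exp ((1 + B) * \<bar>x\<bar>)" by (simp add: distrib_right exp_add)
      finally show "norm (x * f x) \<le> norm (C * exp ((1 + B) * \<bar>x\<bar>))"
        using C by (simp add: abs_mult)
    qed
  qed measurable
  then have i: "integrable lborel (\<lambda>x. x * f x * std_normal_density x)"
    by (simp add: integrable_std_normal_iff)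
  let ?F = "\<lambda>x. f x * std_normal_density x"
  let ?f = "\<lambda>x. f' x * std_normal_density x - x * f x * std_normal_density x"
  have dens: "(std_normal_density has_real_derivative - x * std_normal_density x) (at x)" for x
    unfolding normal_density_def
    by (auto intro!: derivative_eq_intros simp: field_simps)
  have lim: "(?F \<longlongrightarrow> 0) G" if "((\<lambda>x. exp (B * \<bar>x\<bar>) * std_normal_density x) \<longlongrightarrow> 0) G" for G
  proof (rule Lim_null_comparison[OF _ tendsto_mult_right_zero[OF that, of C]])
    show "\<forall>\<^sub>F x in G. norm (f x * std_normal_density x) \<le> C * (exp (B * \<bar>x\<bar>) * std_normal_density x)"
      using mult_right_mono[OF f, of "std_normal_density x" for x]
      by (intro always_eventually allI) (simp add: abs_mult mult.assoc)
  qed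
  have "(LBINT x=-\<infinity>..\<infinity>. ?f x) = 0 - 0"
  proof (rule interval_integral_FTC_integrable)
    fix x :: real
    show "(?F has_vector_derivative ?f x) (at x)"
      unfolding has_real_derivative_iff_has_vector_derivative[symmetric]
      by (auto intro!: derivative_eq_intros deriv dens)
    show "isCont ?f x"
      by (intro continuous_intros cont DERIV_isCont[OF deriv] DERIV_isCont[OF dens])
  next
    show "set_integrable lborel (einterval (- \<infinity>) \<infinity>) ?f"
      using i i' by (simp add: set_integrable_def)
    show "((?F \<circ> real_of_ereal) \<longlongrightarrow> 0) (at_right (- \<infinity>))"
      unfolding comp_def
      using lim[OF exp_abs_times_density_tendsto_0(2)[of B]]
      by (simp add: at_right_MInf filterlim_filtermap)
    show "((?F \<circ> real_of_ereal) \<longlongrightarrow> 0) (at_left \<infinity>)"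
      unfolding comp_def
      using lim[OF exp_abs_times_density_tendsto_0(1)[of B]]
      by (simp add: at_left_PInf filterlim_filtermap)
  qed simp
  then have "(LINT x|lborel. ?f x) = 0"
    by (simp add: interval_lebesgue_integral_def set_lebesgue_integral_def)
  then show ?thesis
    using i i' by (simp add: integral_std_normal)
qed

section \<open>Integration by parts under finite products of standard normals\<close>

abbreviation gauss_product :: "'k set \<Rightarrow> ('k \<Rightarrow> real) measure" where
  "gauss_product K \<equiv> PiM K (\<lambda>_. std_normal)"

text \<open>Common envelope for all integrands: for finite \<open>K\<close> it is integrable at
  every rate, multiplicative in the rate, and a product over the coordinates.\<close>

definition growth :: "'k set \<Rightarrow> real \<Rightarrow> ('k \<Rightarrow> real) \<Rightarrow> real" where
  "growth K B g = exp (B * (\<Sum>k\<in>K. \<bar>g k\<bar>))"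

lemma product_prob_space_std_normal: "product_prob_space (\<lambda>_. std_normal)"
  by (intro product_prob_spaceI prob_space_std_normal)

lemma product_sigma_finite_std_normal: "product_sigma_finite (\<lambda>_. std_normal)"
  using product_prob_space_std_normal unfolding product_prob_space_def by auto

lemma integrable_growth:
  assumes "finite K"
  shows "integrable (gauss_product K) (growth K B)"
proof -
  have "integrable (gauss_product K) (\<lambda>g. \<Prod>k\<in>K. exp (B * \<bar>g k\<bar>))"
    by (intro product_sigma_finite.product_integrable_prod[OF product_sigma_finite_std_normal] assms
        integrable_std_normal_exp_abs)
  then show ?thesis
    using assms by (simp add: growth_def[abs_def] sum_distrib_left exp_sum)
qed

lemma integrable_growth_bound:
  fixes f :: "('k \<Rightarrow> real) \<Rightarrow> real"
  assumes "finite K" "f \<in> borel_measurable (gauss_product K)"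
    and "\<And>g. \<bar>f g\<bar> \<le> C * growth K B g"
  shows "integrable (gauss_product K) f"
  by (rule Bochner_Integration.integrable_bound[OF integrable_mult_right[OF integrable_growth[OF assms(1), of B], of C]])
     (use assms in \<open>auto intro: order_trans[OF _ abs_ge_self]\<close>)

lemma abs_component_le_growth:
  assumes "finite K" "k \<in> K"
  shows "\<bar>g k\<bar> \<le> growth K 1 g"
proof -
  have "\<bar>g k\<bar> \<le> (\<Sum>k\<in>K. \<bar>g k\<bar>)"
    by (rule member_le_sum[where f = "\<lambda>k. \<bar>g k\<bar>"]) (use assms in auto)
  also have "\<dots> \<le> growth K 1 g"
    unfolding growth_def using exp_ge_add_one_self[of "\<Sum>k\<in>K. \<bar>g k\<bar>"] by (simp del: exp_ge_add_one_self)
  finally show ?thesis .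
qed

lemma growth_mult: "growth K A g * growth K B g = growth K (A + B) g"
  by (simp add: growth_def distrib_right exp_add)

text \<open>Fubini isolates coordinate \<open>k\<close>. With the other coordinates frozen the
  one-dimensional identity applies, since the envelope splits and its frozen factor joins the
  constant.\<close>

lemma stein_gauss_product:
  fixes f f' :: "('k \<Rightarrow> real) \<Rightarrow> real"
  assumes K: "finite K" "k \<in> K"
    and [measurable]: "f \<in> borel_measurable (gauss_product K)" "f' \<in> borel_measurable (gauss_product K)"
    and deriv: "\<And>g y. ((\<lambda>y. f (g(k := y))) has_real_derivative f' (g(k := y))) (at y)"
    and cont: "\<And>g y. isCont (\<lambda>y. f' (g(k := y))) y"
    and f: "\<And>g. \<bar>f g\<bar> \<le> C * growth K B g"
    and f': "\<And>g. \<bar>f' g\<bar> \<le> C' * growth K B' g"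
  shows "(\<integral>g. g k * f g \<partial>gauss_product K) = (\<integral>g. f' g \<partial>gauss_product K)"
proof -
  interpret product_sigma_finite "\<lambda>_. std_normal" by (rule product_sigma_finite_std_normal)
  define K' where "K' = K - {k}"
  have K': "finite K'" "k \<notin> K'" "insert k K' = K" using K by (auto simp: K'_def)
  have i': "integrable (gauss_product (insert k K')) f'"
    unfolding K' by (rule integrable_growth_bound[OF _ _ f']) (use K in auto)
  have [measurable]: "(\<lambda>g. g k) \<in> borel_measurable (gauss_product K)"
    using measurable_component_singleton[OF K(2), of "\<lambda>_. std_normal"]
    by (simp cong: measurable_cong_sets)
  have i: "integrable (gauss_product (insert k K')) (\<lambda>g. g k * f g)"
    unfolding K'
  proof (rule integrable_growth_bound[where C = C and B = "1 + B"])
    fix g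
    have "\<bar>g k * f g\<bar> \<le> growth K 1 g * (C * growth K B g)"
      unfolding abs_mult by (intro mult_mono abs_component_le_growth f K) (auto simp: growth_def)
    then show "\<bar>g k * f g\<bar> \<le> C * growth K (1 + B) g"
      by (simp add: growth_mult[symmetric] mult_ac)
  qed (use K in \<open>auto\<close>)
  have upd: "growth K A (g(k := y)) = growth K' A g * exp (A * \<bar>y\<bar>)" for A g y
  proof -
    have "(\<Sum>j\<in>K. \<bar>(g(k := y)) j\<bar>) = \<bar>y\<bar> + (\<Sum>j\<in>K'. \<bar>g j\<bar>)"
      using K' by (subst K'(3)[symmetric]) (auto intro!: sum.cong)
    then show ?thesis by (simp add: growth_def distrib_left exp_add)
  qed
  have "(\<integral>g. g k * f g \<partial>gauss_product K) = (\<integral>g. (\<integral>y. y * f (g(k := y)) \<partial>std_normal) \<partial>gauss_product K')"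
    using product_integral_insert[OF K'(1,2) i] by (simp add: K')
  also have "\<dots> = (\<integral>g. (\<integral>y. f' (g(k := y)) \<partial>std_normal) \<partial>gauss_product K')"
  proof (rule Bochner_Integration.integral_cong[OF refl])
    fix g
    have 1: "\<bar>f (g(k := y))\<bar> \<le> (C * growth K' B g) * exp (B * \<bar>y\<bar>)" for y
      using f[of "g(k := y)"] by (simp add: upd mult_ac)
    have 2: "\<bar>f' (g(k := y))\<bar> \<le> (C' * growth K' B' g) * exp (B' * \<bar>y\<bar>)" for y
      using f'[of "g(k := y)"] by (simp add: upd mult_ac)
    show "(\<integral>y. y * f (g(k := y)) \<partial>std_normal) = (\<integral>y. f' (g(k := y)) \<partial>std_normal)"
      by (rule stein_std_normal[OF deriv cont 1 2])
  qed
  also have "\<dots> = (\<integral>g. f' g \<partial>gauss_product K)"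
    using product_integral_insert[OF K'(1,2) i'] by (simp add: K')
  finally show ?thesis .
qed

text \<open>By the mean value theorem the difference quotients inherit the bound \<open>b\<close>,
  which is therefore required at every \<tau>; dominated convergence along sequences then gives the
  derivative.\<close>

lemma has_real_derivative_integral:
  fixes f f' :: "real \<Rightarrow> 'a \<Rightarrow> real"
  assumes int: "\<And>\<tau>. integrable M (f \<tau>)" and meas: "f' \<tau> \<in> borel_measurable M"
    and deriv: "\<And>\<tau> \<omega>. \<omega> \<in> space M \<Longrightarrow> ((\<lambda>\<tau>. f \<tau> \<omega>) has_real_derivative f' \<tau> \<omega>) (at \<tau>)"
    and bound: "\<And>\<tau> \<omega>. \<omega> \<in> space M \<Longrightarrow> \<bar>f' \<tau> \<omega>\<bar> \<le> b \<omega>" and b: "integrable M b"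
  shows "((\<lambda>\<tau>. \<integral>\<omega>. f \<tau> \<omega> \<partial>M) has_real_derivative (\<integral>\<omega>. f' \<tau> \<omega> \<partial>M)) (at \<tau>)"
  unfolding has_field_derivative_iff tendsto_at_iff_sequentially comp_def
proof (intro allI impI)
  fix X :: "nat \<Rightarrow> real" assume X: "\<forall>i. X i \<in> UNIV - {\<tau>}" "X \<longlonglongrightarrow> \<tau>"
  let ?q = "\<lambda>n \<omega>. (f (X n) \<omega> - f \<tau> \<omega>) / (X n - \<tau>)"
  have "(\<lambda>n. \<integral>\<omega>. ?q n \<omega> \<partial>M) \<longlonglongrightarrow> (\<integral>\<omega>. f' \<tau> \<omega> \<partial>M)"
  proof (rule integral_dominated_convergence[OF meas _ b])
    show "AE \<omega> in M. (\<lambda>n. ?q n \<omega>) \<longlonglongrightarrow> f' \<tau> \<omega>"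
      using deriv[of _ \<tau>] X unfolding has_field_derivative_iff tendsto_at_iff_sequentially comp_def
      by (intro AE_I2) blast
    show "AE \<omega> in M. norm (?q n \<omega>) \<le> b \<omega>" for n
    proof (rule AE_I2)
      fix \<omega> assume \<omega>: "\<omega> \<in> space M"
      have "norm (f (X n) \<omega> - f \<tau> \<omega>) \<le> b \<omega> * norm (X n - \<tau>)"
        by (rule field_differentiable_bound[of UNIV "\<lambda>\<tau>. f \<tau> \<omega>" "\<lambda>\<tau>. f' \<tau> \<omega>"])
           (use deriv[OF \<omega>] bound[OF \<omega>] in auto)
      with X(1) show "norm (?q n \<omega>) \<le> b \<omega>"
        by (auto simp: divide_le_eq abs_divide)
    qed
  qed (use int in auto)
  also have "(\<lambda>n. \<integral>\<omega>. ?q n \<omega> \<partial>M) = (\<lambda>n. ((\<integral>\<omega>. f (X n) \<omega> \<partial>M) - (\<integral>\<omega>. f \<tau> \<omega> \<partial>M)) / (X n - \<tau>))"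
    using int by simp
  finally show "(\<lambda>n. ((\<integral>\<omega>. f (X n) \<omega> \<partial>M) - (\<integral>\<omega>. f \<tau> \<omega> \<partial>M)) / (X n - \<tau>)) \<longlonglongrightarrow> (\<integral>\<omega>. f' \<tau> \<omega> \<partial>M)" .
qed

section \<open>Monotonicity along an interpolation of Gaussian fields\<close>

text \<open>A centered Gaussian field as a linear image of independent coordinates: under
  \<open>gauss_product K\<close> the cross-covariance of the fields of \<open>b\<close> and
  \<open>a\<close> is the sum over \<open>j\<close> of the products of their coefficients.\<close>

definition gfield :: "'k set \<Rightarrow> ('k \<Rightarrow> 'a \<Rightarrow> 'b \<Rightarrow> real) \<Rightarrow> ('k \<Rightarrow> real) \<Rightarrow> 'a \<Rightarrow> 'b \<Rightarrow> real" where
  "gfield K a g i k = (\<Sum>j\<in>K. a j i k * g j)"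

lemma abs_gfield_le:
  assumes "\<And>j. j \<in> K \<Longrightarrow> \<bar>a j i k\<bar> \<le> B"
  shows "\<bar>gfield K a g i k\<bar> \<le> B * (\<Sum>j\<in>K. \<bar>g j\<bar>)"
proof -
  have "\<bar>gfield K a g i k\<bar> \<le> (\<Sum>j\<in>K. \<bar>a j i k * g j\<bar>)"
    unfolding gfield_def by (rule sum_abs)
  also have "\<dots> \<le> (\<Sum>j\<in>K. B * \<bar>g j\<bar>)"
    by (intro sum_mono) (auto simp: abs_mult intro!: mult_right_mono assms)
  finally show ?thesis by (simp add: sum_distrib_left)
qed

lemma measurable_gauss_component:
  assumes "j \<in> K"
  shows "(\<lambda>g. g j) \<in> borel_measurable (gauss_product K)"
  using measurable_component_singleton[OF assms, of "\<lambda>_. std_normal"]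
  by (simp cong: measurable_cong_sets)

lemma measurable_gfield [measurable]:
  "(\<lambda>g. gfield K a g i k) \<in> borel_measurable (gauss_product K)"
  unfolding gfield_def
  by (intro borel_measurable_sum borel_measurable_times borel_measurable_const measurable_gauss_component)

lemma DERIV_gfield_update:
  assumes "finite K" "j \<in> K"
  shows "((\<lambda>y. gfield K a (g(j := y)) i k) has_real_derivative a j i k) (at y)"
proof -
  have "gfield K a (g(j := y)) i k = a j i k * y + (\<Sum>j'\<in>K - {j}. a j' i k * g j')" for y
    unfolding gfield_def using assms by (subst sum.remove[of K j]) auto
  then show ?thesis by (auto intro!: derivative_eq_intros)
qed

section \<open>Integration by parts and monotonicity for the lifted sum of a Gaussian field\<close>

context lifted_sum
begin

lemma measurable_lifted_sum [measurable]:
  assumes [measurable]: "\<And>i k. (\<lambda>x. z x i k) \<in> borel_measurable M"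
  shows "(\<lambda>x. Z (z x) i) \<in> borel_measurable M"
    and "(\<lambda>x. F (z x)) \<in> borel_measurable M"
    and "(\<lambda>x. w (z x) i k) \<in> borel_measurable M"
proof -
  show Z [measurable]: "(\<lambda>x. Z (z x) i) \<in> borel_measurable M" for i
    unfolding Z_def by measurable
  have S [measurable]: "(\<lambda>x. S (z x)) \<in> borel_measurable M"
    unfolding S_def by measurable
  show "(\<lambda>x. F (z x)) \<in> borel_measurable M"
    unfolding F_def by measurable
  show "(\<lambda>x. w (z x) i k) \<in> borel_measurable M"
    unfolding w_def by measurable
qed

lemma measurable_means [measurable]:
  assumes [measurable]: "\<And>i k. (\<lambda>x. z x i k) \<in> borel_measurable M"
    "\<And>i k. (\<lambda>x. v x i k) \<in> borel_measurable M"
  shows "(\<lambda>x. mean (z x) (v x)) \<in> borel_measurable M"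
    and "(\<lambda>x. row_mean (z x) i (v x)) \<in> borel_measurable M"
  unfolding mean_def row_mean_def by measurable

lemma isCont_means:
  fixes z :: "real \<Rightarrow> 'a \<Rightarrow> 'b \<Rightarrow> real"
  assumes z: "\<And>i k. i \<in> I \<Longrightarrow> k \<in> J \<Longrightarrow> isCont (\<lambda>\<tau>. z \<tau> i k) \<tau>"
  shows "isCont (\<lambda>\<tau>. mean (z \<tau>) v) \<tau>"
    and "i \<in> I \<Longrightarrow> isCont (\<lambda>\<tau>. row_mean (z \<tau>) i v) \<tau>"
proof -
  have Z: "isCont (\<lambda>\<tau>. Z (z \<tau>) i) \<tau>" if "i \<in> I" for i
    unfolding Z_def by (intro continuous_intros z that)
  have S: "isCont (\<lambda>\<tau>. S (z \<tau>)) \<tau>"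
    unfolding S_def using Z_pos by (intro continuous_intros Z) (auto simp: less_imp_neq[symmetric])
  show "isCont (\<lambda>\<tau>. mean (z \<tau>) v) \<tau>"
    unfolding mean_def w_def using Z_pos S_pos
    by (intro continuous_intros Z S z) (auto simp: less_imp_neq[symmetric])
  show "isCont (\<lambda>\<tau>. row_mean (z \<tau>) i v) \<tau>" if "i \<in> I"
    unfolding row_mean_def using Z_pos that
    by (intro continuous_intros Z z) (auto simp: less_imp_neq[symmetric])
qed

lemma mean_linear:
  "mean z (\<lambda>i k. \<Sum>j\<in>K. b j * v j i k) = (\<Sum>j\<in>K. b j * mean z (v j))"
  unfolding mean_def
  by (simp add: sum_distrib_left mult_ac sum.swap[of _ K] cong: sum.cong)

lemma row_mean_linear:
  "row_mean z i (\<lambda>i k. \<Sum>j\<in>K. b j * v j i k) = (\<Sum>j\<in>K. b j * row_mean z i (v j))"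
  unfolding row_mean_def sum_distrib_left
  by (subst sum.swap) (intro sum.cong refl, simp add: mult_ac)

lemma F_gfield_le:
  assumes "\<beta> > 0" "c > 0"
    and "\<And>j i k. j \<in> K \<Longrightarrow> i \<in> I \<Longrightarrow> k \<in> J \<Longrightarrow> \<bar>a j i k\<bar> \<le> B"
  shows "F (gfield K a g) \<le> (card I * card J powr \<bar>s\<bar>) powr c * growth K (c * \<bar>s\<bar> * \<beta> * B) g"
  using F_le[of "gfield K a g" "B * (\<Sum>j\<in>K. \<bar>g j\<bar>)"] abs_gfield_le[of K a _ _ B g] assms
  by (simp add: growth_def mult.assoc)

text \<open>Perturbing coordinate \<open>j\<close> moves the field in direction \<open>a j\<close>,
  so \<open>D\<close> is the derivative from \<open>DERIV_F_w\<close> in that direction, and Stein's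
  identity trades the factor \<open>g j\<close> for it. The integrability claims allow finite sums
  to be exchanged with the integral later.\<close>

lemma gaussian_ibp_F_w:
  assumes pos: "\<beta> > 0" "c > 0" and K: "finite K" "j \<in> K" and ik: "i \<in> I" "k \<in> J"
    and B: "\<And>j i k. j \<in> K \<Longrightarrow> i \<in> I \<Longrightarrow> k \<in> J \<Longrightarrow> \<bar>a j i k\<bar> \<le> B"
  defines "D \<equiv> \<lambda>g. \<beta> * (F (gfield K a g) * w (gfield K a g) i k) *
      ((c - 1) * s * mean (gfield K a g) (a j) + (s - 1) * row_mean (gfield K a g) i (a j) + a j i k)"
  shows "(\<integral>g. g j * (F (gfield K a g) * w (gfield K a g) i k) \<partial>gauss_product K) = (\<integral>g. D g \<partial>gauss_product K)"
    and "integrable (gauss_product K) D"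
    and "integrable (gauss_product K) (\<lambda>g. g j * (F (gfield K a g) * w (gfield K a g) i k))"
proof -
  let ?C = "(card I * card J powr \<bar>s\<bar>) powr c" and ?E = "c * \<bar>s\<bar> * \<beta> * B"
  have [measurable]: "D \<in> borel_measurable (gauss_product K)"
    unfolding D_def by measurable
  have [measurable]: "(\<lambda>g. g j) \<in> borel_measurable (gauss_product K)"
    using K(2) by (rule measurable_gauss_component)
  have Fw: "\<bar>F (gfield K a g) * w (gfield K a g) i k\<bar> \<le> ?C * growth K ?E g" for g
  proof -
    have "\<bar>F (gfield K a g) * w (gfield K a g) i k\<bar> \<le> F (gfield K a g) * 1"
      unfolding abs_mult using F_pos[of "gfield K a g"] w_nonneg[of "gfield K a g" i k] w_le_1[OF ik]
      by (intro mult_mono) auto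
    also have "\<dots> \<le> ?C * growth K ?E g"
      using F_gfield_le[OF pos B, where K = K and g = g] by simp
    finally show ?thesis .
  qed
  let ?C' = "\<bar>(c - 1) * s\<bar> * (card I * card J * B) + \<bar>s - 1\<bar> * (card J * B) + B"
  have D: "\<bar>D g\<bar> \<le> (\<beta> * ?C * ?C') * growth K ?E g" for g
  proof -
    let ?z = "gfield K a g"
    have "\<bar>(c - 1) * s * mean ?z (a j) + (s - 1) * row_mean ?z i (a j) + a j i k\<bar>
        \<le> \<bar>(c - 1) * s\<bar> * \<bar>mean ?z (a j)\<bar> + \<bar>s - 1\<bar> * \<bar>row_mean ?z i (a j)\<bar> + \<bar>a j i k\<bar>"
      unfolding abs_mult[symmetric] by (intro order_trans[OF abs_triangle_ineq] add_mono) auto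
    also have "\<dots> \<le> ?C'"
      by (intro add_mono mult_left_mono abs_mean_le abs_row_mean_le B K ik) auto
    finally have *: "\<bar>(c - 1) * s * mean ?z (a j) + (s - 1) * row_mean ?z i (a j) + a j i k\<bar> \<le> ?C'" .
    have "\<bar>D g\<bar> = \<beta> * (\<bar>F ?z * w ?z i k\<bar> *
       \<bar>(c - 1) * s * mean ?z (a j) + (s - 1) * row_mean ?z i (a j) + a j i k\<bar>)"
      unfolding D_def abs_mult using pos by (simp add: mult.assoc)
    also have "\<dots> \<le> \<beta> * ((?C * growth K ?E g) * ?C')"
      using pos by (intro mult_left_mono mult_mono Fw *) (auto simp: growth_def)
    finally show ?thesis by (simp add: mult_ac)
  qed
  show "integrable (gauss_product K) D"
    by (rule integrable_growth_bound[OF K(1) _ D]) measurable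
  show "integrable (gauss_product K) (\<lambda>g. g j * (F (gfield K a g) * w (gfield K a g) i k))"
  proof (rule integrable_growth_bound[OF K(1), where C = ?C and B = "1 + ?E"])
    fix g
    have "\<bar>g j * (F (gfield K a g) * w (gfield K a g) i k)\<bar> \<le> growth K 1 g * (?C * growth K ?E g)"
      unfolding abs_mult[of "g j"] by (intro mult_mono abs_component_le_growth Fw K) (auto simp: growth_def)
    then show "\<bar>g j * (F (gfield K a g) * w (gfield K a g) i k)\<bar> \<le> ?C * growth K (1 + ?E) g"
      by (simp add: growth_mult[symmetric] mult_ac)
  qed measurable
  note dz = DERIV_gfield_update[OF K, where a = a]
  have dFw: "((\<lambda>y. F (gfield K a (g(j := y))) * w (gfield K a (g(j := y))) i k) has_real_derivative D (g(j := y))) (at y)" for g y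
    unfolding D_def by (intro DERIV_F_w dz ik)
  show "(\<integral>g. g j * (F (gfield K a g) * w (gfield K a g) i k) \<partial>gauss_product K) = (\<integral>g. D g \<partial>gauss_product K)"
  proof (rule stein_gauss_product[OF K _ _ dFw _ Fw D])
    show "isCont (\<lambda>y. D (g(j := y))) y" for g y
      unfolding D_def
      by (intro continuous_intros isCont_means DERIV_isCont[OF dz] DERIV_isCont[OF dFw] ik)
  qed measurable
qed

text \<open>Expand the average of the field of \<open>b\<close> into coordinates, integrate each by
  parts and resum. Averages are linear in the direction, so the coefficients enter only through the
  cross-covariance \<open>cov\<close>.\<close>

lemma gaussian_ibp_mean:
  fixes a b :: "'k \<Rightarrow> 'a \<Rightarrow> 'b \<Rightarrow> real"
  assumes pos: "\<beta> > 0" "c > 0" and K: "finite K"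
    and B: "\<And>j i k. j \<in> K \<Longrightarrow> i \<in> I \<Longrightarrow> k \<in> J \<Longrightarrow> \<bar>a j i k\<bar> \<le> B"
  defines "cov \<equiv> \<lambda>i k i' k'. \<Sum>j\<in>K. b j i k * a j i' k'"
  shows "(\<integral>g. F (gfield K a g) * mean (gfield K a g) (gfield K b g) \<partial>gauss_product K) =
    (\<integral>g. (\<Sum>i\<in>I. \<Sum>k\<in>J. \<beta> * (F (gfield K a g) * w (gfield K a g) i k) *
      ((c - 1) * s * mean (gfield K a g) (cov i k) + (s - 1) * row_mean (gfield K a g) i (cov i k) + cov i k i k))
      \<partial>gauss_product K)"
proof -
  note ibp = gaussian_ibp_F_w[OF pos K _ _ _ B]
  let ?Fw = "\<lambda>i k g. F (gfield K a g) * w (gfield K a g) i k"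
  let ?D = "\<lambda>i k j g. \<beta> * ?Fw i k g *
      ((c - 1) * s * mean (gfield K a g) (a j) + (s - 1) * row_mean (gfield K a g) i (a j) + a j i k)"
  \<comment> \<open>Stated for arbitrary integrands so that \<open>?D\<close> stays opaque while
    sums and integral are exchanged.\<close>
  have pull: "(\<Sum>i\<in>I. \<Sum>k\<in>J. \<Sum>j\<in>K. b j i k * (\<integral>g. f i k j g \<partial>gauss_product K))
      = (\<integral>g. (\<Sum>i\<in>I. \<Sum>k\<in>J. \<Sum>j\<in>K. b j i k * f i k j g) \<partial>gauss_product K)"
    if "\<And>i k j. i \<in> I \<Longrightarrow> k \<in> J \<Longrightarrow> j \<in> K \<Longrightarrow> integrable (gauss_product K) (f i k j)"
    for f :: "'a \<Rightarrow> 'b \<Rightarrow> 'k \<Rightarrow> ('k \<Rightarrow> real) \<Rightarrow> real"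
    using that by simp
  have "F (gfield K a g) * mean (gfield K a g) (gfield K b g)
      = (\<Sum>i\<in>I. \<Sum>k\<in>J. \<Sum>j\<in>K. b j i k * (g j * ?Fw i k g))" for g
    unfolding mean_def gfield_def[of K b] by (simp add: sum_distrib_left sum_distrib_right mult_ac)
  then have "(\<integral>g. F (gfield K a g) * mean (gfield K a g) (gfield K b g) \<partial>gauss_product K)
      = (\<integral>g. (\<Sum>i\<in>I. \<Sum>k\<in>J. \<Sum>j\<in>K. b j i k * (g j * ?Fw i k g)) \<partial>gauss_product K)"
    by simp
  also have "\<dots> = (\<Sum>i\<in>I. \<Sum>k\<in>J. \<Sum>j\<in>K. b j i k * (\<integral>g. g j * ?Fw i k g \<partial>gauss_product K))"
    by (simp add: ibp(3))
  also have "\<dots> = (\<Sum>i\<in>I. \<Sum>k\<in>J. \<Sum>j\<in>K. b j i k * (\<integral>g. ?D i k j g \<partial>gauss_product K))"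
    by (intro sum.cong refl arg_cong2[where f = "(*)"] ibp(1))
  also have "\<dots> = (\<integral>g. (\<Sum>i\<in>I. \<Sum>k\<in>J. \<Sum>j\<in>K. b j i k * ?D i k j g) \<partial>gauss_product K)"
    by (rule pull) (rule ibp(2))
  also have "\<dots> = (\<integral>g. (\<Sum>i\<in>I. \<Sum>k\<in>J. \<beta> * ?Fw i k g *
      ((c - 1) * s * mean (gfield K a g) (cov i k) + (s - 1) * row_mean (gfield K a g) i (cov i k) + cov i k i k))
      \<partial>gauss_product K)"
  proof (intro Bochner_Integration.integral_cong refl sum.cong)
    fix g i k
    let ?z = "gfield K a g"
    have "(\<Sum>j\<in>K. b j i k * ?D i k j g) = \<beta> * ?Fw i k g * (\<Sum>j\<in>K.
        (c - 1) * s * (b j i k * mean ?z (a j)) + (s - 1) * (b j i k * row_mean ?z i (a j)) + b j i k * a j i k)"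
      by (subst sum_distrib_left) (intro sum.cong refl, simp add: algebra_simps)
    also have "\<dots> = \<beta> * ?Fw i k g *
      ((c - 1) * s * mean ?z (cov i k) + (s - 1) * row_mean ?z i (cov i k) + cov i k i k)"
      unfolding cov_def mean_linear row_mean_linear by (simp add: sum.distrib sum_distrib_left)
    finally show "(\<Sum>j\<in>K. b j i k * ?D i k j g) = \<beta> * ?Fw i k g *
      ((c - 1) * s * mean ?z (cov i k) + (s - 1) * row_mean ?z i (cov i k) + cov i k i k)" .
  qed
  finally show ?thesis .
qed

lemma integrable_F_gfield:
  assumes "\<beta> > 0" "c > 0" "finite K"
    and "\<And>j i k. j \<in> K \<Longrightarrow> i \<in> I \<Longrightarrow> k \<in> J \<Longrightarrow> \<bar>a j i k\<bar> \<le> B"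
  shows "integrable (gauss_product K) (\<lambda>g. F (gfield K a g))"
  by (rule integrable_growth_bound[OF assms(3)])
     (use F_gfield_le[OF assms(1,2,4)] F_pos in \<open>auto simp: less_imp_le\<close>)

text \<open>\<open>cov_row\<close> removes the row average and the diagonal term. What remains is a
  nonnegative average with total prefactor \<open>c * (c - 1) * s\<^sup>2 * \<beta>\<^sup>2\<close>,
  nonpositive for \<open>c \<le> 1\<close>. The bounds on \<open>A\<close> and \<open>A'\<close>
  range over all \<tau> because differentiation under the integral asks for a global
  envelope.\<close>

lemma expectation_F_nonincreasing:
  fixes A A' :: "real \<Rightarrow> 'k \<Rightarrow> 'a \<Rightarrow> 'b \<Rightarrow> real"
  assumes pos: "\<beta> > 0" "c > 0" and c: "c \<le> 1" and K: "finite K" and ab: "\<tau>\<^sub>0 \<le> \<tau>\<^sub>1"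
    and A: "\<And>\<tau> j i k. ((\<lambda>\<tau>. A \<tau> j i k) has_real_derivative A' \<tau> j i k) (at \<tau>)"
    and B: "\<And>\<tau> j i k. j \<in> K \<Longrightarrow> i \<in> I \<Longrightarrow> k \<in> J \<Longrightarrow> \<bar>A \<tau> j i k\<bar> \<le> B"
    and B': "\<And>\<tau> j i k. j \<in> K \<Longrightarrow> i \<in> I \<Longrightarrow> k \<in> J \<Longrightarrow> \<bar>A' \<tau> j i k\<bar> \<le> B"
    and cov_row: "\<And>\<tau> i k k'. (\<Sum>j\<in>K. A' \<tau> j i k * A \<tau> j i k') = 0"
    and cov_nonneg: "\<And>\<tau> i k i' k'. \<tau>\<^sub>0 \<le> \<tau> \<Longrightarrow> \<tau> \<le> \<tau>\<^sub>1 \<Longrightarrow> (\<Sum>j\<in>K. A' \<tau> j i k * A \<tau> j i' k') \<ge> 0"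
  shows "(\<integral>g. F (gfield K (A \<tau>\<^sub>1) g) \<partial>gauss_product K) \<le> (\<integral>g. F (gfield K (A \<tau>\<^sub>0) g) \<partial>gauss_product K)"
proof (rule DERIV_nonpos_imp_nonincreasing[OF ab])
  fix \<tau> assume \<tau>: "\<tau>\<^sub>0 \<le> \<tau>" "\<tau> \<le> \<tau>\<^sub>1"
  let ?C = "(card I * card J powr \<bar>s\<bar>) powr c" and ?E = "c * \<bar>s\<bar> * \<beta> * B"
  let ?G = "\<lambda>\<tau> g. F (gfield K (A \<tau>) g) * mean (gfield K (A \<tau>) g) (gfield K (A' \<tau>) g)"
  have "((\<lambda>\<tau>. \<integral>g. F (gfield K (A \<tau>) g) \<partial>gauss_product K) has_real_derivative
      (\<integral>g. c * s * \<beta> * ?G \<tau> g \<partial>gauss_product K)) (at \<tau>)"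
  proof (rule has_real_derivative_integral)
    show "integrable (gauss_product K) (\<lambda>g. F (gfield K (A \<tau>) g))" for \<tau>
      by (rule integrable_F_gfield[OF pos K B])
    show "((\<lambda>\<tau>. F (gfield K (A \<tau>) g)) has_real_derivative c * s * \<beta> * ?G \<tau> g) (at \<tau>)" for \<tau> g
      by (rule DERIV_F) (auto simp: gfield_def intro!: derivative_eq_intros A)
    \<comment> \<open>The rate grows by 1 because the derivative field is linear in
      \<open>g\<close>, and the sum of the \<open>\<bar>g j\<bar>\<close> is at most
      \<open>growth K 1 g\<close>. \<open>\<bar>B\<bar>\<close> replaces \<open>B\<close>, whose
      sign is not assumed.\<close>
    let ?b = "\<lambda>g. \<bar>c * s * \<beta>\<bar> * (?C * (card I * card J * \<bar>B\<bar>) * growth K (?E + 1) g)"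
    show "\<bar>c * s * \<beta> * ?G \<tau> g\<bar> \<le> ?b g" for \<tau> g
    proof -
      let ?N = "\<Sum>j\<in>K. \<bar>g j\<bar>"
      have N: "?N \<le> growth K 1 g"
        unfolding growth_def using exp_ge_add_one_self[of ?N] by (simp del: exp_ge_add_one_self)
      have "\<bar>mean (gfield K (A \<tau>) g) (gfield K (A' \<tau>) g)\<bar> \<le> card I * card J * (B * ?N)"
        by (intro abs_mean_le abs_gfield_le B')
      also have "\<dots> \<le> card I * card J * (\<bar>B\<bar> * growth K 1 g)"
        using N by (intro mult_left_mono mult_mono) (auto simp: sum_nonneg)
      finally have *: "\<bar>mean (gfield K (A \<tau>) g) (gfield K (A' \<tau>) g)\<bar> \<le> card I * card J * (\<bar>B\<bar> * growth K 1 g)" .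
      have "\<bar>?G \<tau> g\<bar> \<le> (?C * growth K ?E g) * (card I * card J * (\<bar>B\<bar> * growth K 1 g))"
        unfolding abs_mult using F_pos[of "gfield K (A \<tau>) g"] F_gfield_le[OF pos B[where \<tau> = \<tau>], where g = g]
        by (intro mult_mono *) (auto simp: growth_def)
      also have "\<dots> = ?C * (card I * card J * \<bar>B\<bar>) * growth K (?E + 1) g"
        by (simp add: growth_mult[symmetric] mult_ac)
      finally show ?thesis
        unfolding abs_mult[of "c * s * \<beta>"] by (intro mult_left_mono) auto
    qed
    show "integrable (gauss_product K) ?b"
      by (intro integrable_mult_right integrable_growth K)
  qed measurable
  moreover have "(\<integral>g. c * s * \<beta> * ?G \<tau> g \<partial>gauss_product K) \<le> 0"
  proof -
    let ?cov = "\<lambda>i k i' k'. \<Sum>j\<in>K. A' \<tau> j i k * A \<tau> j i' k'"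
    have row: "row_mean z i (?cov i k) = 0" for z i k
      by (simp add: row_mean_def cov_row)
    have "(\<integral>g. c * s * \<beta> * ?G \<tau> g \<partial>gauss_product K) = c * s * \<beta> * (\<integral>g. (\<Sum>i\<in>I. \<Sum>k\<in>J. \<beta> *
        (F (gfield K (A \<tau>) g) * w (gfield K (A \<tau>) g) i k) *
        ((c - 1) * s * mean (gfield K (A \<tau>) g) (?cov i k))) \<partial>gauss_product K)"
      using gaussian_ibp_mean[OF pos K B[where \<tau> = \<tau>], where b = "A' \<tau>"] by (simp add: row cov_row)
    also have "\<dots> = (\<integral>g. c * s * \<beta> * (\<Sum>i\<in>I. \<Sum>k\<in>J. \<beta> *
        (F (gfield K (A \<tau>) g) * w (gfield K (A \<tau>) g) i k) *
        ((c - 1) * s * mean (gfield K (A \<tau>) g) (?cov i k))) \<partial>gauss_product K)"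
      by simp
    \<comment> \<open>Merges the outer \<open>c * s * \<beta>\<close> with the inner
      \<open>\<beta> * (c - 1) * s\<close> and extracts the minus sign, so that all remaining
      factors are nonnegative.\<close>
    also have "\<dots> = (\<integral>g. - ((c * (1 - c) * s\<^sup>2 * \<beta>\<^sup>2) * (\<Sum>i\<in>I. \<Sum>k\<in>J.
        (F (gfield K (A \<tau>) g) * w (gfield K (A \<tau>) g) i k) *
        mean (gfield K (A \<tau>) g) (?cov i k))) \<partial>gauss_product K)"
      unfolding sum_distrib_left sum_negf[symmetric]
      by (intro Bochner_Integration.integral_cong refl sum.cong) (simp add: power2_eq_square algebra_simps)
    also have "\<dots> = - (\<integral>g. (c * (1 - c) * s\<^sup>2 * \<beta>\<^sup>2) * (\<Sum>i\<in>I. \<Sum>k\<in>J.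
        (F (gfield K (A \<tau>) g) * w (gfield K (A \<tau>) g) i k) *
        mean (gfield K (A \<tau>) g) (?cov i k)) \<partial>gauss_product K)"
      by (rule integral_minus)
    also have "\<dots> \<le> 0"
      unfolding neg_le_0_iff_le
    proof (rule Bochner_Integration.integral_nonneg)
      fix g
      have "mean (gfield K (A \<tau>) g) (?cov i k) \<ge> 0" for i k
        unfolding mean_def by (intro sum_nonneg mult_nonneg_nonneg w_nonneg cov_nonneg \<tau>)
      then show "0 \<le> (c * (1 - c) * s\<^sup>2 * \<beta>\<^sup>2) * (\<Sum>i\<in>I. \<Sum>k\<in>J.
          (F (gfield K (A \<tau>) g) * w (gfield K (A \<tau>) g) i k) * mean (gfield K (A \<tau>) g) (?cov i k))"
        using pos c
        by (intro mult_nonneg_nonneg sum_nonneg w_nonneg less_imp_le[OF F_pos]) auto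
    qed
    finally show ?thesis .
  qed
  ultimately show "\<exists>d. ((\<lambda>\<tau>. \<integral>g. F (gfield K (A \<tau>) g) \<partial>gauss_product K) has_real_derivative d) (at \<tau>) \<and> d \<le> 0"
    by blast
qed

end

section \<open>The limit of infinite inverse temperature and the interpolating field\<close>

lemma tendsto_Max_image:
  fixes f :: "'i \<Rightarrow> 'x \<Rightarrow> real"
  assumes "finite I" "I \<noteq> {}" "\<And>i. i \<in> I \<Longrightarrow> (f i \<longlongrightarrow> L i) G"
  shows "((\<lambda>x. MAX i\<in>I. f i x) \<longlongrightarrow> (MAX i\<in>I. L i)) G"
  using assms
proof (induction I rule: finite_ne_induct)
  case (insert i I)
  then have "((\<lambda>x. max (f i x) (MAX i\<in>I. f i x)) \<longlongrightarrow> max (L i) (MAX i\<in>I. L i)) G"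
    by (intro tendsto_max) auto
  with insert show ?case by simp
qed simp

text \<open>The sum lies between its largest term and \<open>card I\<close> times that term. The
  \<open>f i\<close> may depend on \<beta>, which lets an outer sum take an inner log-sum-exp as
  input.\<close>

lemma log_sum_exp_tendsto_Max:
  fixes f :: "'i \<Rightarrow> real \<Rightarrow> real"
  assumes I: "finite I" "I \<noteq> {}" and f: "\<And>i. i \<in> I \<Longrightarrow> (f i \<longlongrightarrow> L i) at_top"
  shows "((\<lambda>\<beta>. ln (\<Sum>i\<in>I. exp (\<beta> * f i \<beta>)) / \<beta>) \<longlongrightarrow> (MAX i\<in>I. L i)) at_top"
proof (rule tendsto_sandwich)
  let ?m = "\<lambda>\<beta>. MAX i\<in>I. f i \<beta>"
  show "(?m \<longlongrightarrow> (MAX i\<in>I. L i)) at_top"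
    by (rule tendsto_Max_image[OF I f])
  moreover have "((\<lambda>\<beta>. ln (card I) / \<beta>) \<longlongrightarrow> 0) at_top"
    by (rule tendsto_divide_0[OF tendsto_const filterlim_at_top_imp_at_infinity[OF filterlim_ident]])
  ultimately show "((\<lambda>\<beta>. ln (card I) / \<beta> + ?m \<beta>) \<longlongrightarrow> (MAX i\<in>I. L i)) at_top"
    using tendsto_add by fastforce
  have card: "card I > 0" using I by (simp add: card_gt_0_iff)
  show "\<forall>\<^sub>F \<beta> in at_top. ?m \<beta> \<le> ln (\<Sum>i\<in>I. exp (\<beta> * f i \<beta>)) / \<beta>"
    using eventually_gt_at_top[of 0]
  proof eventually_elim
    case (elim \<beta>)
    have "?m \<beta> \<in> (\<lambda>i. f i \<beta>) ` I" using I by (intro Max_in) auto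
    then obtain i where i: "i \<in> I" "?m \<beta> = f i \<beta>" by auto
    have "exp (\<beta> * f i \<beta>) \<le> (\<Sum>i\<in>I. exp (\<beta> * f i \<beta>))"
      by (rule member_le_sum[where f = "\<lambda>i. exp (\<beta> * f i \<beta>)"]) (use i I in auto)
    from ln_mono[OF this] have "\<beta> * ?m \<beta> \<le> ln (\<Sum>i\<in>I. exp (\<beta> * f i \<beta>))"
      by (simp add: i)
    with elim show ?case by (simp add: field_simps)
  qed
  show "\<forall>\<^sub>F \<beta> in at_top. ln (\<Sum>i\<in>I. exp (\<beta> * f i \<beta>)) / \<beta> \<le> ln (card I) / \<beta> + ?m \<beta>"
    using eventually_gt_at_top[of 0]
  proof eventually_elim
    case (elim \<beta>)
    have "(\<Sum>i\<in>I. exp (\<beta> * f i \<beta>)) \<le> (\<Sum>i\<in>I. exp (\<beta> * ?m \<beta>))"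
      using elim I by (intro sum_mono) (auto intro!: mult_left_mono Max_ge)
    then have "(\<Sum>i\<in>I. exp (\<beta> * f i \<beta>)) \<le> card I * exp (\<beta> * ?m \<beta>)" by simp
    moreover have "0 < (\<Sum>i\<in>I. exp (\<beta> * f i \<beta>))" using I by (intro sum_pos) auto
    ultimately have "ln (\<Sum>i\<in>I. exp (\<beta> * f i \<beta>)) \<le> ln (card I * exp (\<beta> * ?m \<beta>))"
      by (rule ln_mono)
    also have "\<dots> = ln (card I) + \<beta> * ?m \<beta>"
      using card by (subst ln_mult) auto
    finally show ?case using elim by (simp add: field_simps)
  qed
qed

text \<open>The previous limit is nested:
  \<open>Z z i powr s = exp (\<beta> * (s * (ln (Z z i) / \<beta>)))\<close> makes the outer sum
  another sum of exponentials, and \<open>F z = exp (C * (ln (S z) / \<beta>))\<close>.\<close>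

lemma lifted_sum_F_tendsto:
  assumes "finite I" "I \<noteq> {}" "finite J" "J \<noteq> {}"
  shows "((\<lambda>\<beta>. lifted_sum.F I J \<beta> s (C / \<beta>) z) \<longlongrightarrow> exp (C * (MAX i\<in>I. s * (MAX k\<in>J. z i k)))) at_top"
proof -
  let ?r = "\<lambda>i \<beta>. ln (\<Sum>k\<in>J. exp (\<beta> * z i k)) / \<beta>"
  have "((\<lambda>\<beta>. exp (C * (ln (\<Sum>i\<in>I. exp (\<beta> * (s * ?r i \<beta>))) / \<beta>)))
      \<longlongrightarrow> exp (C * (MAX i\<in>I. s * (MAX k\<in>J. z i k)))) at_top"
    using assms
    by (intro tendsto_exp tendsto_mult_left log_sum_exp_tendsto_Max[of I "\<lambda>i \<beta>. s * ?r i \<beta>"]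
        log_sum_exp_tendsto_Max[of J "\<lambda>k \<beta>. z i k" for i] tendsto_const)
  then show ?thesis
  proof (rule Lim_transform_eventually)
    show "\<forall>\<^sub>F \<beta> in at_top. exp (C * (ln (\<Sum>i\<in>I. exp (\<beta> * (s * ?r i \<beta>))) / \<beta>))
        = lifted_sum.F I J \<beta> s (C / \<beta>) z"
      using eventually_gt_at_top[of 0]
    proof eventually_elim
      case (elim \<beta>)
      interpret lifted_sum I J \<beta> s "C / \<beta>" by standard (use assms in auto)
      have "exp (\<beta> * (s * ?r i \<beta>)) = Z z i powr s" for i
        using elim Z_pos[of z i] by (simp add: powr_def Z_def)
      then show ?case
        using S_pos[of z] by (simp add: F_def S_def powr_def)
    qed
  qed
qed

section \<open>The concrete Gaussian coordinates and the trigonometric interpolation\<close>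

lemma UNIV_gauss_index:
  "(UNIV :: ('m, 'n) gauss_index set) =
     range (\<lambda>(i, j). IdxG i j) \<union> range IdxU2 \<union> range IdxH \<union> {IdxU4}"
proof -
  have "q \<in> range (\<lambda>(i, j). IdxG i j) \<union> range IdxU2 \<union> range IdxH \<union> {IdxU4}"
    for q :: "('m, 'n) gauss_index"
    by (cases q) auto
  then show ?thesis by blast
qed

lemma finite_gauss_index: "finite (UNIV :: ('m::finite, 'n::finite) gauss_index set)"
  by (subst UNIV_gauss_index) simp

lemma sum_gauss_index:
  fixes f :: "('m::finite, 'n::finite) gauss_index \<Rightarrow> real"
  shows "(\<Sum>q\<in>UNIV. f q) = (\<Sum>i\<in>UNIV. \<Sum>j\<in>UNIV. f (IdxG i j)) + (\<Sum>i\<in>UNIV. f (IdxU2 i))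
    + (\<Sum>j\<in>UNIV. f (IdxH j)) + f IdxU4"
proof -
  have "(\<Sum>q\<in>range (\<lambda>(i, j). IdxG i j). f q) = (\<Sum>i\<in>UNIV. \<Sum>j\<in>UNIV. f (IdxG i j))"
    by (subst sum.reindex) (auto simp: inj_on_def sum.cartesian_product intro!: sum.cong)
  moreover have "(\<Sum>q\<in>range IdxU2. f q) = (\<Sum>i\<in>UNIV. f (IdxU2 i))"
    "(\<Sum>q\<in>range IdxH. f q) = (\<Sum>j\<in>UNIV. f (IdxH j))"
    by (subst sum.reindex; simp add: inj_on_def)+
  ultimately show ?thesis
    by (subst UNIV_gauss_index) (subst sum.union_disjoint; (auto; fail)?)+
qed

text \<open>Since a quarter turn differentiates both \<open>sin\<close> and \<open>cos\<close>, the derivative of this family at \<open>\<theta>\<close> is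
  its value at \<open>\<theta> + pi / 2\<close>.\<close>

fun interp_coeff ::
  "(nat \<Rightarrow> real^'n) \<Rightarrow> (nat \<Rightarrow> real^'m) \<Rightarrow> real \<Rightarrow> ('m, 'n) gauss_index \<Rightarrow> nat \<Rightarrow> nat \<Rightarrow> real" where
  "interp_coeff x y \<theta> (IdxG a b) i k = sin \<theta> * (y k $ a * x i $ b)"
| "interp_coeff x y \<theta> (IdxU2 a) i k = cos \<theta> * (norm (x i) * y k $ a)"
| "interp_coeff x y \<theta> (IdxH b) i k = cos \<theta> * (norm (y k) * x i $ b)"
| "interp_coeff x y \<theta> IdxU4 i k = sin \<theta> * (norm (x i) * norm (y k))"

lemma DERIV_interp_coeff:
  "((\<lambda>\<theta>. interp_coeff x y \<theta> q i k) has_real_derivative interp_coeff x y (\<theta> + pi / 2) q i k) (at \<theta>)"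
  by (cases q) (auto intro!: derivative_eq_intros simp: sin_add cos_add)

text \<open>Uniform in \<theta>, so it also covers the derivative, which is the coefficient at a
  shifted angle.\<close>

lemma abs_interp_coeff_le: "\<bar>interp_coeff x y \<theta> q i k\<bar> \<le> norm (x i) * norm (y k)"
proof -
  have 1: "\<bar>u * (p * r)\<bar> \<le> P * R" if "\<bar>u\<bar> \<le> 1" "\<bar>p\<bar> \<le> P" "\<bar>r\<bar> \<le> R" for u p r P R :: real
  proof -
    have "\<bar>u * (p * r)\<bar> \<le> 1 * (P * R)"
      unfolding abs_mult using that by (intro mult_mono) auto
    then show ?thesis by simp
  qed
  \<comment> \<open>\<open>IdxH\<close> yields the two norms in reversed order, hence the
    disjunction.\<close>
  have "\<bar>interp_coeff x y \<theta> q i k\<bar> \<le> norm (x i) * norm (y k)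
      \<or> \<bar>interp_coeff x y \<theta> q i k\<bar> \<le> norm (y k) * norm (x i)"
    by (cases q) (auto intro: 1 component_le_norm_cart abs_sin_le_one abs_cos_le_one)
  then show ?thesis by (auto simp: mult.commute)
qed

text \<open>The blocks \<open>IdxG\<close> and \<open>IdxU4\<close> carry
  \<open>cos \<theta> * sin \<theta>\<close>, the blocks \<open>IdxU2\<close> and
  \<open>IdxH\<close> carry \<open>- sin \<theta> * cos \<theta>\<close>; the four resulting terms
  factor into two Cauchy-Schwarz defects.\<close>

lemma interp_coeff_cov:
  fixes x :: "nat \<Rightarrow> real^'n" and y :: "nat \<Rightarrow> real^'m"
  shows "(\<Sum>q\<in>UNIV. interp_coeff x y (\<theta> + pi / 2) q i k * interp_coeff x y \<theta> q i' k') =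
    sin \<theta> * cos \<theta> * ((norm (x i) * norm (x i') - x i \<bullet> x i') * (norm (y k) * norm (y k') - y k \<bullet> y k'))"
proof -
  have "(\<Sum>a\<in>UNIV. \<Sum>b\<in>UNIV. (y k $ a * x i $ b) * (y k' $ a * x i' $ b)) = (y k \<bullet> y k') * (x i \<bullet> x i')"
    by (simp add: inner_vec_def sum_product mult_ac)
  moreover have "(\<Sum>a\<in>UNIV. (norm (x i) * y k $ a) * (norm (x i') * y k' $ a)) = norm (x i) * norm (x i') * (y k \<bullet> y k')"
    "(\<Sum>b\<in>UNIV. (norm (y k) * x i $ b) * (norm (y k') * x i' $ b)) = norm (y k) * norm (y k') * (x i \<bullet> x i')"
    by (simp_all add: inner_vec_def sum_distrib_left mult_ac)
  moreover have "(\<Sum>q\<in>UNIV. interp_coeff x y (\<theta> + pi / 2) q i k * interp_coeff x y \<theta> q i' k') =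
    sin \<theta> * cos \<theta> * ((\<Sum>a\<in>UNIV. \<Sum>b\<in>UNIV. (y k $ a * x i $ b) * (y k' $ a * x i' $ b))
      - (\<Sum>a\<in>UNIV. (norm (x i) * y k $ a) * (norm (x i') * y k' $ a))
      - (\<Sum>b\<in>UNIV. (norm (y k) * x i $ b) * (norm (y k') * x i' $ b))
      + norm (x i) * norm (y k) * (norm (x i') * norm (y k')))"
    unfolding sum_gauss_index
    by (simp add: sin_add cos_add distrib_left right_diff_distrib sum_distrib_left sum_negf mult_ac)
  ultimately show ?thesis by (simp add: algebra_simps)
qed

text \<open>At the angle with sine \<open>sqrt t\<close> and cosine \<open>sqrt (1 - t)\<close> the
  four coefficient blocks reproduce the four summands of \<open>H_interp\<close>.\<close>

lemma H_interp_eq_gfield: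
  fixes x :: "nat \<Rightarrow> real^'n" and y :: "nat \<Rightarrow> real^'m"
  assumes "t \<in> {0..1}"
  shows "H_interp (G \<omega>) (u2 \<omega>) (h \<omega>) (u4 \<omega>) t (x i) (y k) =
    gfield UNIV (interp_coeff x y (arcsin (sqrt t))) (\<lambda>q. gauss_component G u2 h u4 q \<omega>) i k"
proof -
  have "sin (arcsin (sqrt t)) = sqrt t" "cos (arcsin (sqrt t)) = sqrt (1 - t)"
    using assms order_trans[of "-1" 0 "sqrt t"] by (simp_all add: sin_arcsin cos_arcsin)
  moreover have "y k \<bullet> (G \<omega> *v x i) = (\<Sum>a\<in>UNIV. \<Sum>b\<in>UNIV. y k $ a * x i $ b * G \<omega> $ a $ b)"
    by (simp add: inner_vec_def matrix_vector_mult_def sum_distrib_left mult_ac)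
  ultimately show ?thesis
    unfolding H_interp_def gfield_def sum_gauss_index
    by (simp add: inner_vec_def sum_distrib_left mult_ac)
qed

section \<open>Transfer to \<open>psi_star\<close>\<close>

lemma distr_gauss_component:
  assumes "prob_space M" "iid_std_normal_components M G u2 h u4"
  shows "distr M (PiM UNIV (\<lambda>_. borel)) (\<lambda>\<omega> q. gauss_component G u2 h u4 q \<omega>) = gauss_product UNIV"
    and "\<And>q. gauss_component G u2 h u4 q \<in> borel_measurable M"
proof -
  interpret prob_space M by fact
  let ?X = "gauss_component G u2 h u4"
  from assms(2) have indep: "indep_vars (\<lambda>_. borel) ?X UNIV"
    and d: "\<And>q. distributed M lborel (?X q) std_normal_density"
    by (auto simp: iid_std_normal_components_def)
  show rv: "?X q \<in> borel_measurable M" for q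
    using distributed_measurable[OF d[of q]] by simp
  have "distr M borel (?X q) = std_normal" for q
  proof -
    have "distr M borel (?X q) = distr M lborel (?X q)" by (rule distr_cong) auto
    then show ?thesis using distributed_distr_eq_density[OF d[of q]] by (simp add: std_normal_def)
  qed
  \<comment> \<open>Independence says that the joint law is the product of the marginal laws, each
    of which is \<open>std_normal\<close>.\<close>
  then show "distr M (PiM UNIV (\<lambda>_. borel)) (\<lambda>\<omega> q. ?X q \<omega>) = gauss_product UNIV"
    using indep indep_vars_iff_distr_eq_PiM[where I = UNIV and M' = "\<lambda>_. borel" and X = ?X] rv
    by (simp add: restrict_def)
qed

text \<open>Replaces the abstract probability space by the law of the coordinates, where product
  integration and integration by parts are available.\<close>

lemma psi_star_eq:
  fixes x :: "nat \<Rightarrow> real^'n" and y :: "nat \<Rightarrow> real^'m"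
  assumes "prob_space M" "iid_std_normal_components M G u2 h u4" and l: "l \<ge> 1" and t: "t \<in> {0..1}"
  shows "psi_star M G u2 h u4 l x y \<beta> s c t =
    (\<integral>g. lifted_sum.F {1..l} {1..l} \<beta> s c (gfield UNIV (interp_coeff x y (arcsin (sqrt t))) g) \<partial>gauss_product UNIV)"
proof -
  interpret lifted_sum "{1..l}" "{1..l}" \<beta> s c by standard (use l in auto)
  note distr = distr_gauss_component[OF assms(1,2)]
  let ?X = "\<lambda>\<omega> q. gauss_component G u2 h u4 q \<omega>"
  let ?f = "\<lambda>g. F (gfield UNIV (interp_coeff x y (arcsin (sqrt t))) g)"
  have X: "?X \<in> measurable M (PiM UNIV (\<lambda>_. borel))"
    using distr(2) by (intro measurable_PiM_single') (auto simp: space_PiM)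
  have "?f \<in> borel_measurable (gauss_product UNIV)" by measurable
  \<comment> \<open>A distribution carries the sigma-algebra of its target, so both product spaces
    have the same measurable functions.\<close>
  then have f: "?f \<in> borel_measurable (PiM UNIV (\<lambda>_. borel))"
    by (simp add: distr(1)[symmetric])
  have "psi_star M G u2 h u4 l x y \<beta> s c t = (\<integral>\<omega>. ?f (?X \<omega>) \<partial>M)"
    unfolding psi_star_def F_def S_def Z_def H_interp_eq_gfield[OF t] ..
  also have "\<dots> = (\<integral>g. ?f g \<partial>distr M (PiM UNIV (\<lambda>_. borel)) ?X)"
    using integral_distr[OF X f] by simp
  finally show ?thesis by (simp add: distr(1))
qed

lemma interp_coeff_uniform_bound:
  fixes l :: nat
  shows "\<exists>B. \<forall>\<theta> q. \<forall>i\<in>{1..l}. \<forall>k\<in>{1..l}. \<bar>interp_coeff x y \<theta> q i k\<bar> \<le> B"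
proof (intro exI[of _ "(\<Sum>i=1..l. norm (x i)) * (\<Sum>k=1..l. norm (y k))"] allI ballI)
  fix \<theta> q i k assume *: "i \<in> {1..l}" "k \<in> {1..l}"
  have "\<bar>interp_coeff x y \<theta> q i k\<bar> \<le> norm (x i) * norm (y k)"
    by (rule abs_interp_coeff_le)
  also have "\<dots> \<le> (\<Sum>i=1..l. norm (x i)) * (\<Sum>k=1..l. norm (y k))"
    using * by (intro mult_mono member_le_sum[where f = "\<lambda>i. norm (x i)"] member_le_sum[where f = "\<lambda>k. norm (y k)"])
      (auto simp: sum_nonneg)
  finally show "\<bar>interp_coeff x y \<theta> q i k\<bar> \<le> (\<Sum>i=1..l. norm (x i)) * (\<Sum>k=1..l. norm (y k))" .
qed

text \<open>\<open>arcsin (sqrt t)\<close> increases with \<open>t\<close> and stays in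
  \<open>[0, pi / 2]\<close>, where sine and cosine are nonnegative; with Cauchy-Schwarz the
  cross-covariance is nonnegative there.\<close>

lemma psi_star_antimono:
  fixes x :: "nat \<Rightarrow> real^'n" and y :: "nat \<Rightarrow> real^'m"
  assumes M: "prob_space M" "iid_std_normal_components M G u2 h u4" and l: "l \<ge> 1"
    and pos: "\<beta> > 0" "c > 0" and c: "c \<le> 1"
  shows "antimono_on {0..1} (psi_star M G u2 h u4 l x y \<beta> s c)"
proof (rule monotone_onI)
  fix t t' :: real assume t: "t \<in> {0..1}" "t' \<in> {0..1}" "t \<le> t'"
  interpret lifted_sum "{1..l}" "{1..l}" \<beta> s c by standard (use l in auto)
  let ?A = "interp_coeff x y"
  obtain B where B: "\<And>\<theta> q i k. i \<in> {1..l} \<Longrightarrow> k \<in> {1..l} \<Longrightarrow> \<bar>?A \<theta> q i k\<bar> \<le> B"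
    using interp_coeff_uniform_bound by blast
  have r: "arcsin (sqrt t) \<le> arcsin (sqrt t')" "0 \<le> arcsin (sqrt t)" "arcsin (sqrt t') \<le> pi / 2"
    using t order_trans[of "-1" 0 "sqrt t"] order_trans[of "-1" 0 "sqrt t'"] arcsin_le_arcsin[of 0 "sqrt t"]
      arcsin_ubound[of "sqrt t'"]
    by (auto intro!: arcsin_le_arcsin)
  have "(\<integral>g. F (gfield UNIV (?A (arcsin (sqrt t'))) g) \<partial>gauss_product UNIV)
      \<le> (\<integral>g. F (gfield UNIV (?A (arcsin (sqrt t))) g) \<partial>gauss_product UNIV)"
  proof (rule expectation_F_nonincreasing[OF pos c finite_gauss_index r(1), where A' = "\<lambda>\<theta>. ?A (\<theta> + pi / 2)" and B = B])
    fix \<theta> i k i' k' assume \<theta>: "arcsin (sqrt t) \<le> \<theta>" "\<theta> \<le> arcsin (sqrt t')"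
    have "0 \<le> sin \<theta>" "0 \<le> cos \<theta>"
      using \<theta> r by (auto intro!: sin_ge_zero cos_ge_zero)
    moreover have "x i \<bullet> x i' \<le> norm (x i) * norm (x i')" "y k \<bullet> y k' \<le> norm (y k) * norm (y k')"
      by (rule norm_cauchy_schwarz)+
    ultimately show "0 \<le> (\<Sum>q\<in>UNIV. ?A (\<theta> + pi / 2) q i k * ?A \<theta> q i' k')"
      unfolding interp_coeff_cov by (intro mult_nonneg_nonneg) auto
  next
    \<comment> \<open>Within one row the defect of \<open>x i\<close> against itself is
      zero.\<close>
    show "(\<Sum>q\<in>UNIV. ?A (\<theta> + pi / 2) q i k * ?A \<theta> q i k') = 0" for \<theta> i k k'
      unfolding interp_coeff_cov by (simp add: dot_square_norm power2_eq_square)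
  qed (auto intro: DERIV_interp_coeff B)
  then show "psi_star M G u2 h u4 l x y \<beta> s c t \<ge> psi_star M G u2 h u4 l x y \<beta> s c t'"
    unfolding psi_star_eq[OF M l t(1)] psi_star_eq[OF M l t(2)] .
qed

text \<open>Dominated convergence: the exponent \<open>C / \<beta>\<close> cancels the \<beta> in
  the growth rate, leaving the rate \<open>C * \<bar>s\<bar> * B\<close>, free of \<beta>.\<close>

lemma psi_star_tendsto:
  fixes x :: "nat \<Rightarrow> real^'n" and y :: "nat \<Rightarrow> real^'m"
  assumes M: "prob_space M" "iid_std_normal_components M G u2 h u4" and l: "l \<ge> 1"
    and C: "C > 0" and t: "t \<in> {0..1}"
  shows "((\<lambda>\<beta>. psi_star M G u2 h u4 l x y \<beta> s (C / \<beta>) t) \<longlongrightarrow>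
    (\<integral>g. exp (C * (MAX i\<in>{1..l}. s * (MAX k\<in>{1..l}.
      gfield UNIV (interp_coeff x y (arcsin (sqrt t))) g i k))) \<partial>gauss_product UNIV)) at_top"
proof -
  let ?a = "interp_coeff x y (arcsin (sqrt t))"
  have ls: "lifted_sum {1..l} {1..l}" by standard (use l in auto)
  obtain B where B: "\<And>\<theta> q i k. i \<in> {1..l} \<Longrightarrow> k \<in> {1..l} \<Longrightarrow> \<bar>interp_coeff x y \<theta> q i k\<bar> \<le> B"
    using interp_coeff_uniform_bound by blast
  let ?b = "\<lambda>g :: ('m, 'n) gauss_index \<Rightarrow> real. (real l * real l powr \<bar>s\<bar>) powr C * growth UNIV (C * \<bar>s\<bar> * B) g"
  show ?thesis
    unfolding psi_star_eq[OF M l t]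
  proof (rule integral_dominated_convergence_at_top[where w = ?b])
    show "integrable (gauss_product UNIV) ?b"
      by (intro integrable_mult_right integrable_growth finite_gauss_index)
    show "AE g in gauss_product UNIV. ((\<lambda>\<beta>. lifted_sum.F {1..l} {1..l} \<beta> s (C / \<beta>) (gfield UNIV ?a g))
        \<longlongrightarrow> exp (C * (MAX i\<in>{1..l}. s * (MAX k\<in>{1..l}. gfield UNIV ?a g i k)))) at_top"
      using l by (intro AE_I2 lifted_sum_F_tendsto) auto
    show "(\<lambda>g. lifted_sum.F {1..l} {1..l} \<beta> s (C / \<beta>) (gfield UNIV ?a g)) \<in> borel_measurable (gauss_product UNIV)" for \<beta>
      by (rule lifted_sum.measurable_lifted_sum[OF ls]) measurable
    show "\<forall>\<^sub>F \<beta> in at_top. AE g in gauss_product UNIV.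
        norm (lifted_sum.F {1..l} {1..l} \<beta> s (C / \<beta>) (gfield UNIV ?a g)) \<le> ?b g"
      \<comment> \<open>For \<open>\<beta> \<ge> 1\<close> the exponent \<open>C / \<beta>\<close>
        is at most \<open>C\<close>; the base of the prefactor is at least 1, so exponent
        \<open>C\<close> dominates.\<close>
      using eventually_ge_at_top[of 1]
    proof eventually_elim
      case (elim \<beta>)
      then have pos: "\<beta> > 0" "C / \<beta> > 0" using C by auto
      show ?case
      proof (rule AE_I2)
        fix g
        let ?F = "lifted_sum.F {1..l} {1..l} \<beta> s (C / \<beta>) (gfield UNIV ?a g)"
        have "?F \<le> (real l * real l powr \<bar>s\<bar>) powr (C / \<beta>) * growth UNIV (C * \<bar>s\<bar> * B) g"
          using lifted_sum.F_gfield_le[OF ls pos B[where \<theta> = "arcsin (sqrt t)"], where K = UNIV and g = g] pos by simp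
        also have "\<dots> \<le> ?b g"
        proof (rule mult_right_mono[OF powr_mono])
          have "1 * 1 \<le> real l * real l powr \<bar>s\<bar>"
            using l by (intro mult_mono ge_one_powr_ge_zero) auto
          then show "1 \<le> real l * real l powr \<bar>s\<bar>" by simp
          show "C / \<beta> \<le> C" using elim C by (simp add: divide_le_eq)
        qed (simp add: growth_def)
        finally show "norm ?F \<le> ?b g"
          using lifted_sum.F_pos[OF ls, of \<beta> s "C / \<beta>" "gfield UNIV ?a g"] by simp
      qed
    qed
  qed measurable
qed

section \<open>Monotonicity for large \<beta> and passage to the limit\<close>

theorem corollary3:
  fixes M :: "'w measure"
    and G :: "'w \<Rightarrow> real^'n^'m" and u2 :: "'w \<Rightarrow> real^'m"
    and h :: "'w \<Rightarrow> real^'n" and u4 :: "'w \<Rightarrow> real"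
    and l :: nat and x :: "nat \<Rightarrow> real^'n" and y :: "nat \<Rightarrow> real^'m"
    and s c3s :: real
  assumes "prob_space M"
    and "iid_std_normal_components M G u2 h u4"
    and "l \<ge> 1"
    and "c3s > 0"
  shows "(\<forall>\<^sub>F \<beta> in at_top. antimono_on {0..1} (\<lambda>t. psi_star M G u2 h u4 l x y \<beta> s (c3s / \<beta>) t)) \<and>
    (\<exists>L :: real \<Rightarrow> real.
       (\<forall>t\<in>{0..1}. ((\<lambda>\<beta>. psi_star M G u2 h u4 l x y \<beta> s (c3s / \<beta>) t) \<longlongrightarrow> L t) at_top) \<and>
       (\<forall>t\<in>{0..1}. L 0 \<ge> L t \<and> L t \<ge> L 1))"
proof -
  let ?\<psi> = "\<lambda>\<beta> t. psi_star M G u2 h u4 l x y \<beta> s (c3s / \<beta>) t"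
  have anti: "\<forall>\<^sub>F \<beta> in at_top. antimono_on {0..1} (?\<psi> \<beta>)"
    \<comment> \<open>For positive \<beta>, \<open>\<beta> \<ge> c3s\<close> means
      \<open>c3s / \<beta> \<le> 1\<close>, the condition on the outer exponent.\<close>
    using eventually_gt_at_top[of 0] eventually_ge_at_top[of c3s]
  proof eventually_elim
    case (elim \<beta>)
    then show ?case
      using assms by (intro psi_star_antimono) (auto simp: divide_le_eq)
  qed
  have "\<forall>t\<in>{0..1}. \<exists>a. ((\<lambda>\<beta>. ?\<psi> \<beta> t) \<longlongrightarrow> a) at_top"
    using psi_star_tendsto[OF assms] by blast
  then obtain L where L: "\<And>t. t \<in> {0..1} \<Longrightarrow> ((\<lambda>\<beta>. ?\<psi> \<beta> t) \<longlongrightarrow> L t) at_top"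
    by metis
  \<comment> \<open>Inequalities that hold eventually pass to the limit, so only the existence of
    the limits matters, not their values.\<close>
  have "L t' \<le> L t" if "t \<in> {0..1}" "t' \<in> {0..1}" "t \<le> t'" for t t'
  proof (rule tendsto_le[OF _ L L])
    show "\<forall>\<^sub>F \<beta> in at_top. ?\<psi> \<beta> t' \<le> ?\<psi> \<beta> t"
      using anti by eventually_elim (use that in \<open>auto simp: monotone_on_def\<close>)
  qed (use that in auto)
  then have "\<forall>t\<in>{0..1}. L 0 \<ge> L t \<and> L t \<ge> L 1" by auto
  with anti L show ?thesis by blast
qed

end
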